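(* Let $a=\{a_n(t): n\in\mathbb{N}, t>0\}$ be a rate with $a_n(t)\ge a_n(s)$ for $t>s$ and such that for every $t>0$, $\lim_{n\to\infty}a_n(t)=\infty$. There exists a dense $G_\delta$ subset $G\subset\mathcal{M}$ (in the weak topology) such that for each $T\in G$ the lower slow entropy of $T$ with respect to $a_n(t)$ is zero, i.e. $\text{s-}\underline{\mathcal{H}}^{\mu}_{a}(T)=0$.
   Context: $(X,\mathcal{B},\mu)$ is a standard probability space (isomorphic to $[0,1]$ with Lebesgue measure). $\mathcal{M}$ is the set of invertible $\mu$-preserving maps $T:X\to X$ (identified modulo null sets), with the weak topology, i.e. the topology induced by the strong operator topology on the Koopman operators $U_T$. A rate is a family of positive real numbers $a_n(t)$, $n\in\mathbb{N}$, $t>0$. For words $w,w'$ of length $n$, the normalized Hamming distance $d(w,w')$ is $\frac1n$ times the number of positions where $w$ and $w'$ differ. For a finite measurable partition $P=\{p_1,\dots,p_r\}$, $T\in\mathcal{M}$ and $x\in X$, let $\vec{P}_n(x)=\langle w_1,\dots,w_n\rangle\in\{1,\dots,r\}^n$ with $T^{i-1}x\in p_{w_i}$. For $w\in\{1,\dots,r\}^n$ let $B^{T,P}_{\varepsilon}(w)=\{x\in X: d(\vec{P}_n(x),w)<\varepsilon\}$. Define $$S_P(T,n,\varepsilon,\delta)=\min\Big\{k:\exists v_1,\dots,v_k\in\{1,\dots,r\}^n,\ \mu\Big(\bigcup_{i=1}^k B^{T,P}_\varepsilon(v_i)\Big)\ge 1-\delta\Big\}.$$ Lower slow entropy: let $\underline{\mathcal{G}}(\varepsilon,\delta,P)=\{t>0:\liminf_{n\to\infty}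 S_P(T,n,\varepsilon,\delta)/a_n(t)>0\}$; let $\text{s-}\underline{\mathcal{H}}(\varepsilon,\delta,P)=\sup\underline{\mathcal{G}}(\varepsilon,\delta,P)$ if this set is nonempty and $0$ otherwise; $\text{s-}\underline{\mathcal{H}}^\mu_a(T,P)=\lim_{\delta\to0}\lim_{\varepsilon\to0}\text{s-}\underline{\mathcal{H}}(\varepsilon,\delta,P)$; and $\text{s-}\underline{\mathcal{H}}^\mu_a(T)=\sup_P \text{s-}\underline{\mathcal{H}}^\mu_a(T,P)$, the supremum over finite measurable partitions $P$. *)

theory Defs
  imports "HOL-Probability.Probability"
begin

section \<open>Standard probability spaces and their automorphisms\<close>

definition measure_isomorphism :: "'a measure \<Rightarrow> 'b measure \<Rightarrow> ('a \<Rightarrow> 'b) \<Rightarrow> bool" where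
  "measure_isomorphism M N f \<longleftrightarrow>
     bij_betw f (space M) (space N) \<and>
     f \<in> M \<rightarrow>\<^sub>M N \<and> the_inv_into (space M) f \<in> N \<rightarrow>\<^sub>M M \<and>
     distr M N f = N"

definition isomorphic_mod_null :: "'a measure \<Rightarrow> 'b measure \<Rightarrow> bool" where
  "isomorphic_mod_null M N \<longleftrightarrow>
     (\<exists>A\<in>null_sets M. \<exists>B\<in>null_sets N. \<exists>f.
        measure_isomorphism (restrict_space M (space M - A)) (restrict_space N (space N - B)) f)"

text \<open>Both usual conventions are admitted: the \<open>\<sigma>\<close>-algebra of the unit interval may be the
  Borel one or its Lebesgue completion.\<close>

definition standard_probability_space :: "'a measure \<Rightarrow> bool" where
  "standard_probability_space M \<longleftrightarrow>
     isomorphic_mod_null M (restrict_space lborel {0..1::real}) \<or>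
     isomorphic_mod_null M (lebesgue_on {0..1::real})"

text \<open>Representatives are strict bijections of \<^term>\<open>space M\<close>. A transformation that is
  invertible only off a null set restricts to a bijection of an invariant set of full measure;
  extending that by the identity gives a strict representative of its class.\<close>

definition automorphisms :: "'a measure \<Rightarrow> ('a \<Rightarrow> 'a) set" where
  "automorphisms M = {T. measure_isomorphism M M T}"

definition ae_equal :: "'a measure \<Rightarrow> (('a \<Rightarrow> 'a) \<times> ('a \<Rightarrow> 'a)) set" where
  "ae_equal M = {(S, T). S \<in> automorphisms M \<and> T \<in> automorphisms M \<and> (AE x in M. S x = T x)}"

definition automorphism_classes :: "'a measure \<Rightarrow> ('a \<Rightarrow> 'a) set set" where
  "automorphism_classes M = automorphisms M // ae_equal M"

section \<open>The weak topology\<close>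

definition square_integrable :: "'a measure \<Rightarrow> ('a \<Rightarrow> complex) set" where
  "square_integrable M =
     {f \<in> borel_measurable M. integrable M (\<lambda>x. (cmod (f x))\<^sup>2)}"

definition l2_norm :: "'a measure \<Rightarrow> ('a \<Rightarrow> complex) \<Rightarrow> real" where
  "l2_norm M f = sqrt (\<integral>x. (cmod (f x))\<^sup>2 \<partial>M)"

definition koopman :: "('a \<Rightarrow> 'a) \<Rightarrow> ('a \<Rightarrow> complex) \<Rightarrow> ('a \<Rightarrow> complex)" where
  "koopman T f = f \<circ> T"

text \<open>The subbasis consists of the preimages, under the Koopman representation, of the subbasic
  strong operator neighbourhoods of Koopman operators. The norm below is the same for all
  representatives of the class \<open>c\<close>.\<close>

definition weak_topology :: "'a measure \<Rightarrow> ('a \<Rightarrow> 'a) set topology" where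
  "weak_topology M = topology_generated_by
     {{c \<in> automorphism_classes M.
         \<forall>S\<in>c. l2_norm M (\<lambda>x. koopman S f x - koopman T f x) < \<epsilon>} | T f \<epsilon>.
       T \<in> automorphisms M \<and> f \<in> square_integrable M \<and> \<epsilon> > 0}"

section \<open>Lower slow entropy\<close>

text \<open>A partition is a pair \<open>(r, p)\<close> with the atoms \<open>p 1, \<dots>, p r\<close>; values of \<open>p\<close> at other
  indices are irrelevant. Words are lists, so their positions start at \<open>0\<close>.\<close>

definition finite_partition :: "'a measure \<Rightarrow> nat \<Rightarrow> (nat \<Rightarrow> 'a set) \<Rightarrow> bool" where
  "finite_partition M r p \<longleftrightarrow>
     (\<forall>i\<in>{1..r}. p i \<in> sets M \<and> p i \<noteq> {}) \<and>
     disjoint_family_on p {1..r} \<and> (\<Union>i\<in>{1..r}. p i) = space M"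

definition orbit_word ::
    "nat \<Rightarrow> (nat \<Rightarrow> 'a set) \<Rightarrow> ('a \<Rightarrow> 'a) \<Rightarrow> nat \<Rightarrow> 'a \<Rightarrow> nat list" where
  "orbit_word r p T n x = map (\<lambda>i. THE j. j \<in> {1..r} \<and> (T ^^ i) x \<in> p j) [0..<n]"

definition words :: "nat \<Rightarrow> nat \<Rightarrow> nat list set" where
  "words r n = {w. length w = n \<and> set w \<subseteq> {1..r}}"

definition hamming_dist :: "nat list \<Rightarrow> nat list \<Rightarrow> real" where
  "hamming_dist w w' = real (card {i. i < length w \<and> w ! i \<noteq> w' ! i}) / real (length w)"

definition hamming_ball ::
    "'a measure \<Rightarrow> nat \<Rightarrow> (nat \<Rightarrow> 'a set) \<Rightarrow> ('a \<Rightarrow> 'a) \<Rightarrow> real \<Rightarrow> nat list \<Rightarrow> 'a set" where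
  "hamming_ball M r p T \<epsilon> w =
     {x \<in> space M. hamming_dist (orbit_word r p T (length w) x) w < \<epsilon>}"

definition covering_number ::
    "'a measure \<Rightarrow> nat \<Rightarrow> (nat \<Rightarrow> 'a set) \<Rightarrow> ('a \<Rightarrow> 'a) \<Rightarrow> nat \<Rightarrow> real \<Rightarrow> real \<Rightarrow> nat" where
  "covering_number M r p T n \<epsilon> \<delta> =
     (LEAST k. \<exists>vs. length vs = k \<and> set vs \<subseteq> words r n \<and>
        measure M (\<Union>v\<in>set vs. hamming_ball M r p T \<epsilon> v) \<ge> 1 - \<delta>)"

definition lower_growth_params ::
    "'a measure \<Rightarrow> (nat \<Rightarrow> real \<Rightarrow> real) \<Rightarrow> ('a \<Rightarrow> 'a) \<Rightarrow> nat \<Rightarrow> (nat \<Rightarrow> 'a set) \<Rightarrow>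
       real \<Rightarrow> real \<Rightarrow> real set" where
  "lower_growth_params M a T r p \<epsilon> \<delta> =
     {t. t > 0 \<and>
        liminf (\<lambda>n. ereal (real (covering_number M r p T n \<epsilon> \<delta>) / a n t)) > 0}"

definition lower_slow_entropy_at ::
    "'a measure \<Rightarrow> (nat \<Rightarrow> real \<Rightarrow> real) \<Rightarrow> ('a \<Rightarrow> 'a) \<Rightarrow> nat \<Rightarrow> (nat \<Rightarrow> 'a set) \<Rightarrow>
       real \<Rightarrow> real \<Rightarrow> ereal" where
  "lower_slow_entropy_at M a T r p \<epsilon> \<delta> =
     (if lower_growth_params M a T r p \<epsilon> \<delta> = {} then 0
      else Sup (ereal ` lower_growth_params M a T r p \<epsilon> \<delta>))"

text \<open>The covering numbers are antitone in \<open>\<epsilon>\<close> and in \<open>\<delta>\<close>, so both one-sided limits exist in the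
  extended reals, and \<^const>\<open>Lim\<close> denotes them.\<close>

definition lower_slow_entropy_partition ::
    "'a measure \<Rightarrow> (nat \<Rightarrow> real \<Rightarrow> real) \<Rightarrow> ('a \<Rightarrow> 'a) \<Rightarrow> nat \<Rightarrow> (nat \<Rightarrow> 'a set) \<Rightarrow> ereal" where
  "lower_slow_entropy_partition M a T r p =
     Lim (at_right 0) (\<lambda>\<delta>. Lim (at_right 0) (\<lambda>\<epsilon>. lower_slow_entropy_at M a T r p \<epsilon> \<delta>))"

definition lower_slow_entropy ::
    "'a measure \<Rightarrow> (nat \<Rightarrow> real \<Rightarrow> real) \<Rightarrow> ('a \<Rightarrow> 'a) \<Rightarrow> ereal" where
  "lower_slow_entropy M a T =
     (SUP (r, p) \<in> {(r, p). finite_partition M r p}. lower_slow_entropy_partition M a T r p)"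

end

theory Submission
  imports Defs
begin

text \<open>
  The idea is that a periodic map has only boundedly many names, whatever their length, while the
  rate is unbounded; so a map that imitates a periodic map for a very long time has a small
  covering number at that time, and a generic map does this at infinitely many times.

  In detail, let \<open>R\<close> satisfy \<open>R ^^ q = id\<close>. For every partition into \<open>r\<close> sets and every length
  \<open>n\<close>, the map \<open>R\<close> has at most \<open>r ^ q\<close> names of length \<open>n\<close>. If the preimages of the atoms under
  \<open>T ^^ i\<close> and \<open>R ^^ i\<close> are close for all \<open>i < n\<close>, then by Markov's inequality most points have
  \<open>T\<close>-name and \<open>R\<close>-name at small Hamming distance, so the names of \<open>R\<close> serve as centres for \<open>T\<close>
  (\<open>covering_number_near_periodic\<close>). As \<open>a n t\<close> tends to infinity, \<open>n\<close> can be chosen, after \<open>q\<close>,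
  so large that \<open>r ^ q\<close> is negligible against \<open>a n t\<close>. Closeness up to a fixed time \<open>n\<close> is a weakly
  open condition on \<open>T\<close> (\<open>periodic_has_weak_neighbourhood\<close>). Testing it on the first \<open>m\<close> members of
  a countable family of sets that is dense in the measure algebra defines a weakly open set \<open>U m\<close>
  that contains all periodic maps, and \<open>G = (\<Inter>m. U m)\<close> is the required set: each of its members has
  times with relatively small covering number for every partition
  (\<open>lower_growth_params_empty\<close>).

  It remains to see that \<open>G\<close> is dense. This is a Baire category argument, carried out not for the
  weak topology but for the finer uniform distance \<open>\<mu> {S \<noteq> T}\<close>. Two facts make this work. The
  uniform distance is complete, because a sequence with summable distances is almost everywhere
  eventually constant by Borel-Cantelli (\<open>limit_automorphism\<close>); the limit is then visibly a point
  map. And the periodic maps are already dense for the uniform distance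
  (\<open>periodic_approximation\<close>): cut the orbits of \<open>T\<close> at a measurable set \<open>B\<close> that every orbit visits
  with gaps which are bounded above and, apart from short periodic orbits, are longer than \<open>n\<close>; then
  let the new map agree with \<open>T\<close> except that, instead of entering \<open>B\<close>, it goes back to the previous
  visit.

  Of the standard space only this is used: there is a real function \<open>\<phi>\<close>, injective off a null set,
  such that every measurable set is, modulo a null set, the preimage of a Borel set
  (locale \<open>separated_prob_space\<close>).
\<close>

section \<open>Invertible measure preserving maps\<close>

text \<open>Keeping the inverse as a second map makes the two directions symmetric and avoids
  \<^const>\<open>the_inv_into\<close>, which is awkward because only the values on \<^term>\<open>space M\<close> are controlled.\<close>
definition inverse_automorphisms :: "'a measure \<Rightarrow> ('a \<Rightarrow> 'a) \<Rightarrow> ('a \<Rightarrow> 'a) \<Rightarrow> bool" where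
  "inverse_automorphisms M T R \<longleftrightarrow>
     T \<in> M \<rightarrow>\<^sub>M M \<and> R \<in> M \<rightarrow>\<^sub>M M \<and> distr M M T = M \<and> distr M M R = M \<and>
     (\<forall>x\<in>space M. R (T x) = x \<and> T (R x) = x)"

lemma inverse_automorphismsI:
  assumes T: "T \<in> M \<rightarrow>\<^sub>M M" and R: "R \<in> M \<rightarrow>\<^sub>M M" and d: "distr M M T = M"
    and "\<And>x. x \<in> space M \<Longrightarrow> R (T x) = x" "\<And>x. x \<in> space M \<Longrightarrow> T (R x) = x"
  shows "inverse_automorphisms M T R"
proof -
  have "distr M M R = distr (distr M M T) M R" using d by simp
  also have "\<dots> = distr M M (R \<circ> T)" by (rule distr_distr[OF R T])
  also have "\<dots> = distr M M (\<lambda>x. x)" by (rule distr_cong) (auto simp: assms)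
  also have "\<dots> = M" by (simp add: distr_id)
  finally show ?thesis using assms unfolding inverse_automorphisms_def by blast
qed

lemma inverse_automorphisms_sym: "inverse_automorphisms M T R \<Longrightarrow> inverse_automorphisms M R T"
  by (auto simp: inverse_automorphisms_def)

lemma automorphisms_iff: "T \<in> automorphisms M \<longleftrightarrow> (\<exists>R. inverse_automorphisms M T R)"
  (is "_ \<longleftrightarrow> ?ex")
proof
  assume "T \<in> automorphisms M"
  then have b: "bij_betw T (space M) (space M)" and T: "T \<in> M \<rightarrow>\<^sub>M M"
    and R: "the_inv_into (space M) T \<in> M \<rightarrow>\<^sub>M M" and d: "distr M M T = M"
    by (auto simp: automorphisms_def measure_isomorphism_def)
  have "inverse_automorphisms M T (the_inv_into (space M) T)"
    using b T R d
    by (intro inverse_automorphismsI)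
       (auto simp: bij_betw_def the_inv_into_f_f f_the_inv_into_f)
  then show ?ex by blast
next
  assume ?ex
  then obtain R where R: "inverse_automorphisms M T R" ..
  then have T: "T \<in> M \<rightarrow>\<^sub>M M" "R \<in> M \<rightarrow>\<^sub>M M" and d: "distr M M T = M"
    and inv: "\<And>x. x \<in> space M \<Longrightarrow> R (T x) = x" "\<And>x. x \<in> space M \<Longrightarrow> T (R x) = x"
    by (auto simp: inverse_automorphisms_def)
  note sp = measurable_space[OF T(1)] measurable_space[OF T(2)]
  have b: "bij_betw T (space M) (space M)"
    by (rule bij_betwI[where g = R]) (auto simp: sp inv)
  have "the_inv_into (space M) T y = R y" if "y \<in> space M" for y
    using b that by (intro the_inv_into_f_eq) (auto simp: bij_betw_def sp inv)
  then have "the_inv_into (space M) T \<in> M \<rightarrow>\<^sub>M M"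
    using T(2) by (subst measurable_cong[where g = R]) auto
  then show "T \<in> automorphisms M"
    using b T d by (auto simp: automorphisms_def measure_isomorphism_def)
qed

lemma automorphism_measurable: "T \<in> automorphisms M \<Longrightarrow> T \<in> M \<rightarrow>\<^sub>M M"
  and automorphism_distr: "T \<in> automorphisms M \<Longrightarrow> distr M M T = M"
  by (auto simp: automorphisms_def measure_isomorphism_def)

lemma automorphism_in_space: "T \<in> automorphisms M \<Longrightarrow> x \<in> space M \<Longrightarrow> T x \<in> space M"
  using automorphism_measurable measurable_space by metis

lemma distr_preserves_emeasure:
  assumes "T \<in> M \<rightarrow>\<^sub>M M" "distr M M T = M" "E \<in> sets M"
  shows "emeasure M {x \<in> space M. T x \<in> E} = emeasure M E"
  using emeasure_distr[OF assms(1,3)] assms(2)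
  by (simp add: vimage_def Int_def conj_commute)

lemma distr_preserves_measure:
  assumes "T \<in> M \<rightarrow>\<^sub>M M" "distr M M T = M" "E \<in> sets M"
  shows "measure M {x \<in> space M. T x \<in> E} = measure M E"
  using distr_preserves_emeasure[OF assms] by (simp add: measure_def)

lemma distr_preserves_AE:
  assumes "T \<in> M \<rightarrow>\<^sub>M M" "distr M M T = M" "AE x in M. P x"
  shows "AE x in M. P (T x)"
  using assms AE_distrD by metis

lemma measurable_funpow:
  assumes "T \<in> M \<rightarrow>\<^sub>M M"
  shows "(T ^^ n) \<in> M \<rightarrow>\<^sub>M M"
  using assms by (induction n) (auto simp: measurable_comp)

lemma distr_funpow:
  assumes "T \<in> M \<rightarrow>\<^sub>M M" "distr M M T = M"
  shows "distr M M (T ^^ n) = M"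
proof (induction n)
  case 0 show ?case by (simp add: distr_id id_def)
next
  case (Suc n)
  have "distr M M (T ^^ Suc n) = distr (distr M M (T ^^ n)) M T"
    by (subst distr_distr[OF assms(1) measurable_funpow[OF assms(1)]]) (simp only: funpow.simps)
  then show ?case by (simp only: Suc assms(2))
qed

text \<open>Null sets are removed by passing to the set \<open>Y\<close> of points whose whole forward and backward
  orbits avoid them. This set is invariant and of full measure, and redefining the map as the
  identity off \<open>Y\<close> gives a bijection of the whole type, so that integer iterates can be computed
  with afterwards without side conditions.\<close>
lemma (in prob_space) invertible_version:
  assumes T[measurable]: "T \<in> M \<rightarrow>\<^sub>M M" and R[measurable]: "R \<in> M \<rightarrow>\<^sub>M M"
    and dT: "distr M M T = M" and dR: "distr M M R = M" and Z: "Z \<in> null_sets M"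
    and RT: "\<And>x. x \<in> space M - Z \<Longrightarrow> R (T x) = x"
    and TR: "\<And>x. x \<in> space M - Z \<Longrightarrow> T (R x) = x"
  obtains U V Y where "\<And>x. V (U x) = x" "\<And>x. U (V x) = x" "inverse_automorphisms M U V"
    "AE x in M. U x = T x" "Y \<subseteq> space M - Z" "\<And>x. x \<in> Y \<Longrightarrow> U x \<in> Y" "\<And>x. x \<notin> Y \<Longrightarrow> U x = x"
proof -
  have [measurable]: "Z \<in> sets M" using Z by auto
  note [measurable] = measurable_funpow[OF T] measurable_funpow[OF R]
  define Y where "Y = {x \<in> space M. \<forall>i. (T ^^ i) x \<notin> Z \<and> (R ^^ i) x \<notin> Z}"
  have [measurable]: "Y \<in> sets M" unfolding Y_def by measurable
  have "AE x in M. (T ^^ i) x \<notin> Z" "AE x in M. (R ^^ i) x \<notin> Z" for i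
    using distr_preserves_AE[OF measurable_funpow[OF T] distr_funpow[OF T dT] AE_not_in[OF Z]]
      distr_preserves_AE[OF measurable_funpow[OF R] distr_funpow[OF R dR] AE_not_in[OF Z]] by auto
  then have "AE x in M. \<forall>i. (T ^^ i) x \<notin> Z \<and> (R ^^ i) x \<notin> Z"
    by (simp add: AE_all_countable)
  then have AEY: "AE x in M. x \<in> Y" by (auto simp: Y_def)
  have YZ: "x \<in> space M - Z" if "x \<in> Y" for x
  proof -
    have "(T ^^ 0) x \<notin> Z" using that unfolding Y_def by blast
    then show ?thesis using that by (simp add: Y_def)
  qed
  have TY: "T x \<in> Y" if "x \<in> Y" for x
  proof -
    have x: "\<And>i. (T ^^ i) x \<notin> Z" "\<And>i. (R ^^ i) x \<notin> Z"
      using that by (auto simp: Y_def)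
    have "(T ^^ i) (T x) \<notin> Z" for i using x(1)[of "Suc i"] by (simp add: funpow_swap1)
    moreover have "(R ^^ i) (T x) \<notin> Z" for i
      using x(1)[of 1] x(2)[of "i - 1"] RT[OF YZ[OF that]] by (cases i) (simp_all add: funpow_swap1)
    ultimately show ?thesis using measurable_space[OF T] YZ[OF that] by (simp add: Y_def)
  qed
  have RY: "R x \<in> Y" if "x \<in> Y" for x
  proof -
    have x: "\<And>i. (T ^^ i) x \<notin> Z" "\<And>i. (R ^^ i) x \<notin> Z"
      using that by (auto simp: Y_def)
    have "(R ^^ i) (R x) \<notin> Z" for i using x(2)[of "Suc i"] by (simp add: funpow_swap1)
    moreover have "(T ^^ i) (R x) \<notin> Z" for i
      using x(2)[of 1] x(1)[of "i - 1"] TR[OF YZ[OF that]] by (cases i) (simp_all add: funpow_swap1)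
    ultimately show ?thesis using measurable_space[OF R] YZ[OF that] by (simp add: Y_def)
  qed
  define U V where "U x = (if x \<in> Y then T x else x)" and "V x = (if x \<in> Y then R x else x)" for x
  have [measurable]: "U \<in> M \<rightarrow>\<^sub>M M" "V \<in> M \<rightarrow>\<^sub>M M"
    unfolding U_def[abs_def] V_def[abs_def] by measurable
  have VU: "V (U x) = x" and UV: "U (V x) = x" for x
    using TY[of x] RY[of x] YZ[of x] RT[of x] TR[of x] by (auto simp: U_def V_def)
  have UT: "AE x in M. U x = T x" using AEY by eventually_elim (simp add: U_def)
  have "distr M M U = distr M M T" by (rule distr_cong_AE) (use UT in auto)
  then have "inverse_automorphisms M U V"
    using dT by (intro inverse_automorphismsI) (auto simp: UV VU)
  then show thesis using YZ TY by (intro that[of V U Y] VU UV UT) (auto simp: U_def)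
qed

text \<open>Each piece is moved by a measure preserving map, and injectivity makes the images of the pieces
  disjoint; so preimages of \<open>E\<close> have measure at most that of \<open>E\<close>. Applied to the complement, the same
  inequality gives equality.\<close>
lemma (in prob_space) piecewise_preserving:
  assumes c[measurable]: "c \<in> M \<rightarrow>\<^sub>M count_space (UNIV :: nat set)"
    and gh: "\<And>j. inverse_automorphisms M (g j) (h j)"
    and inj: "inj_on (\<lambda>x. g (c x) x) (space M)"
  shows "(\<lambda>x. g (c x) x) \<in> M \<rightarrow>\<^sub>M M" "distr M M (\<lambda>x. g (c x) x) = M"
proof -
  define S where "S = (\<lambda>x. g (c x) x)"
  have g[measurable]: "g j \<in> M \<rightarrow>\<^sub>M M" and h[measurable]: "h j \<in> M \<rightarrow>\<^sub>M M"
    and dh: "distr M M (h j) = M" for j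
    using gh[of j] by (auto simp: inverse_automorphisms_def)
  have gh1: "g j (h j x) = x" if "x \<in> space M" for j x
    using gh[of j] that by (auto simp: inverse_automorphisms_def)
  have hs: "h j x \<in> space M" if "x \<in> space M" for j x using measurable_space[OF h that] .
  show S: "(\<lambda>x. g (c x) x) \<in> M \<rightarrow>\<^sub>M M"
    by (rule measurable_compose_countable[OF g c])
  then have S'[measurable]: "S \<in> M \<rightarrow>\<^sub>M M" by (simp add: S_def)
  have le: "emeasure M {x \<in> space M. S x \<in> E} \<le> emeasure M E" if E[measurable]: "E \<in> sets M" for E
  proof -
    define Z where "Z j = {x \<in> space M. c x = j \<and> g j x \<in> E}" for j
    define Z' where "Z' j = {y \<in> space M. h j y \<in> Z j}" for j
    have Z[measurable]: "Z j \<in> sets M" "Z' j \<in> sets M" for j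
      unfolding Z_def Z'_def by measurable
    have "{x \<in> space M. S x \<in> E} = (\<Union>j. Z j)" by (auto simp: Z_def S_def)
    then have "emeasure M {x \<in> space M. S x \<in> E} \<le> (\<Sum>j. emeasure M (Z j))"
      using emeasure_subadditive_countably[of Z M] Z by (simp add: image_subset_iff)
    also have "\<dots> = (\<Sum>j. emeasure M (Z' j))"
      unfolding Z'_def by (subst distr_preserves_emeasure[OF h dh]) auto
    also have "\<dots> = emeasure M (\<Union>j. Z' j)"
    proof (rule suminf_emeasure)
      show "disjoint_family Z'"
      proof (unfold disjoint_family_on_def, intro ballI impI)
        fix i j :: nat assume ij: "i \<noteq> j"
        show "Z' i \<inter> Z' j = {}"
        proof (rule ccontr)
          assume "Z' i \<inter> Z' j \<noteq> {}"
          then obtain y where y: "y \<in> space M" "c (h i y) = i" "c (h j y) = j"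
            by (auto simp: Z'_def Z_def)
          then have "g (c (h i y)) (h i y) = g (c (h j y)) (h j y)" by (simp add: gh1)
          then have "h i y = h j y" using inj y(1) hs by (auto dest: inj_onD)
          with y ij show False by metis
        qed
      qed
    qed auto
    also have "\<dots> \<le> emeasure M E"
      by (rule emeasure_mono) (auto simp: Z'_def Z_def gh1)
    finally show ?thesis .
  qed
  have "distr M M S = M"
  proof (rule measure_eqI)
    fix E assume "E \<in> sets (distr M M S)"
    then have E[measurable]: "E \<in> sets M" by simp
    have "measure M {x \<in> space M. S x \<in> E} \<le> measure M E"
      using le[OF E] by (simp add: emeasure_eq_measure)
    moreover have "measure M {x \<in> space M. S x \<in> space M - E} \<le> measure M (space M - E)"
      using le[of "space M - E"] by (simp add: emeasure_eq_measure)
    moreover have "{x \<in> space M. S x \<in> space M - E} = space M - {x \<in> space M. S x \<in> E}"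
      using measurable_space[OF S'] by auto
    ultimately have "measure M {x \<in> space M. S x \<in> E} = measure M E"
      by (simp add: prob_compl)
    then show "emeasure (distr M M S) E = emeasure M E"
      by (simp add: emeasure_distr emeasure_eq_measure vimage_def Int_def conj_commute)
  qed simp
  then show "distr M M (\<lambda>x. g (c x) x) = M" by (simp add: S_def)
qed

section \<open>Cutting orbits into columns\<close>

text \<open>A greedy construction of a set that meets every orbit segment of length \<open>2 * n + 1\<close> but never
  contains two points of an orbit at time distance at most \<open>n\<close> with different values of \<open>\<phi>\<close>.
  These values serve to tell points apart: \<open>A k\<close> collects the points \<open>x\<close> with \<open>\<phi> x\<close> in the basic open set \<open>J k\<close> for which no
  different value of \<open>\<phi>\<close> on the orbit segment around \<open>x\<close> lies in \<open>J k\<close>, so \<open>A k\<close> is itself spaced. The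
  countably many \<open>A k\<close> cover the space; they are added one after the other, leaving out points that
  are near to what was chosen before.\<close>
lemma spaced_sweeping_set:
  fixes \<phi> :: "'a \<Rightarrow> real"
  assumes \<phi>[measurable]: "\<phi> \<in> borel_measurable M"
    and U[measurable]: "U \<in> M \<rightarrow>\<^sub>M M" and V[measurable]: "V \<in> M \<rightarrow>\<^sub>M M"
    and VU: "\<And>x. V (U x) = x" and UV: "\<And>x. U (V x) = x"
  obtains B where "B \<in> sets M"
    and "\<And>x i. x \<in> B \<Longrightarrow> i \<le> n \<Longrightarrow> (U ^^ i) x \<in> B \<Longrightarrow> \<phi> ((U ^^ i) x) = \<phi> x"
    and "\<And>x. x \<in> space M \<Longrightarrow> \<exists>i\<le>n. (U ^^ i) x \<in> B \<or> (V ^^ i) x \<in> B"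
proof -
  note [measurable] = measurable_funpow[OF U] measurable_funpow[OF V]
  have VUn: "(V ^^ i) ((U ^^ i) x) = x" for i x
    by (induction i arbitrary: x) (simp_all add: VU funpow_swap1)
  obtain \<B> :: "real set set" where \<B>: "countable \<B>" "topological_basis \<B>"
    using ex_countable_basis by blast
  have ne: "\<B> \<noteq> {}"
    using topological_basisE[OF \<B>(2) open_UNIV UNIV_I] by blast
  define J where "J k = from_nat_into \<B> k" for k
  have J: "open (J k)" for k
    using from_nat_into[OF ne] topological_basis_open[OF \<B>(2)] by (simp add: J_def)
  have [measurable]: "J k \<in> sets borel" for k using J by simp
  define A where "A k = {x \<in> space M. \<phi> x \<in> J k \<and>
      (\<forall>i\<le>n. (\<phi> ((U ^^ i) x) = \<phi> x \<or> \<phi> ((U ^^ i) x) \<notin> J k) \<and>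
             (\<phi> ((V ^^ i) x) = \<phi> x \<or> \<phi> ((V ^^ i) x) \<notin> J k))}" for k
  have [measurable]: "A k \<in> sets M" for k unfolding A_def by measurable
  have A_cover: "\<exists>k. x \<in> A k" if x: "x \<in> space M" for x
  proof -
    define F where "F = (\<lambda>i. \<phi> ((U ^^ i) x)) ` {..n} \<union> (\<lambda>i. \<phi> ((V ^^ i) x)) ` {..n} - {\<phi> x}"
    have "finite F" by (simp add: F_def)
    then have "open (- F)" by (simp add: finite_imp_closed open_Compl)
    moreover have "\<phi> x \<in> - F" by (simp add: F_def)
    ultimately obtain b where b: "b \<in> \<B>" "\<phi> x \<in> b" "b \<subseteq> - F"
      using topological_basisE[OF \<B>(2)] by metis
    obtain k where "J k = b"
      using from_nat_into_surj[OF \<B>(1) b(1)] by (auto simp: J_def)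
    then have "x \<in> A k" using x b by (auto simp: A_def F_def)
    then show ?thesis ..
  qed
  define near where "near B = {x \<in> space M. \<exists>i\<le>n. (U ^^ i) x \<in> B \<or> (V ^^ i) x \<in> B}" for B
  define Bs where "Bs = rec_nat {} (\<lambda>k B. B \<union> (A k - near B))"
  have Bs: "Bs 0 = {}" "Bs (Suc k) = Bs k \<union> (A k - near (Bs k))" for k
    by (simp_all add: Bs_def)
  have Bs_sets[measurable]: "Bs k \<in> sets M" for k
  proof (induction k)
    case (Suc k)
    note Suc[measurable]
    have "near (Bs k) \<in> sets M" unfolding near_def by measurable
    then show ?case by (simp add: Bs)
  qed (simp add: Bs)
  have mono: "mono Bs" by (simp add: mono_iff_le_Suc Bs)
  have Bs_sub: "Bs k \<subseteq> space M" for k using sets.sets_into_space[OF Bs_sets] .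
  have spaced: "\<phi> ((U ^^ i) x) = \<phi> x"
    if "x \<in> Bs k" "i \<le> n" "(U ^^ i) x \<in> Bs k" for x i k
    using that(1,3)
  proof (induction k)
    case (Suc k)
    have "x \<in> space M" "(U ^^ i) x \<in> space M" using Suc.prems Bs_sub by auto
    moreover have "x \<in> A k \<Longrightarrow> (U ^^ i) x \<in> A k \<Longrightarrow> \<phi> ((U ^^ i) x) = \<phi> x"
      using that(2) by (auto simp: A_def)
    moreover have "\<not> ((U ^^ i) x \<in> Bs k \<and> x \<notin> near (Bs k) \<and> x \<in> space M)"
      using that(2) by (auto simp: near_def)
    moreover have "\<not> (x \<in> Bs k \<and> (U ^^ i) x \<notin> near (Bs k) \<and> (U ^^ i) x \<in> space M)"
      using that(2) VUn[of i x] by (auto simp: near_def)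
    ultimately show ?case using Suc by (auto simp: Bs)
  qed (simp add: Bs)
  show thesis
  proof
    show "(\<Union>k. Bs k) \<in> sets M" by measurable
    show "\<phi> ((U ^^ i) x) = \<phi> x" if x: "x \<in> (\<Union>k. Bs k)" and i: "i \<le> n" and Ux: "(U ^^ i) x \<in> (\<Union>k. Bs k)" for x i
    proof -
      obtain k l where "x \<in> Bs k" "(U ^^ i) x \<in> Bs l" using x Ux by auto
      then have "x \<in> Bs (max k l)" "(U ^^ i) x \<in> Bs (max k l)"
        using monoD[OF mono, of k "max k l"] monoD[OF mono, of l "max k l"] by auto
      then show ?thesis using spaced i by blast
    qed
    show "\<exists>i\<le>n. (U ^^ i) x \<in> (\<Union>k. Bs k) \<or> (V ^^ i) x \<in> (\<Union>k. Bs k)" if x: "x \<in> space M" for x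
    proof -
      obtain k where k: "x \<in> A k" using A_cover x by blast
      show ?thesis
      proof (cases "x \<in> near (Bs k)")
        case True then show ?thesis by (auto simp: near_def)
      next
        case False
        then have "(U ^^ 0) x \<in> Bs (Suc k)" using k by (simp add: Bs)
        then show ?thesis by blast
      qed
    qed
  qed
qed

text \<open>An orbit is cut by \<open>B\<close> into columns \<open>y, U y, \<dots>, (U ^^ (h - 1)) y\<close> with only the base point \<open>y\<close>
  in \<open>B\<close>, and \<open>S\<close> runs cyclically through each column. The heights \<open>h\<close> are at most \<open>Suc N\<close>, hence
  divide its factorial.\<close>
lemma return_map_periodic:
  fixes U V S :: "'a \<Rightarrow> 'a" and N :: nat
  assumes VU: "\<And>x. V (U x) = x" and UV: "\<And>x. U (V x) = x"
    and B: "B \<subseteq> X" and UX: "\<And>x. x \<in> X \<Longrightarrow> U x \<in> X"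
    and backward: "\<And>x. x \<in> X \<Longrightarrow> \<exists>j. (V ^^ j) x \<in> B"
    and forward: "\<And>x. x \<in> X \<Longrightarrow> \<exists>j\<le>N. (U ^^ j) x \<in> B"
    and S: "\<And>x. x \<in> X \<Longrightarrow> S x = (if U x \<in> B then (V ^^ (LEAST j. (V ^^ j) x \<in> B)) x else U x)"
    and x: "x \<in> X"
  shows "(S ^^ fact (Suc N)) x = x"
proof -
  have VUn: "(V ^^ j) ((U ^^ i) x) = (U ^^ (i - j)) x" if "j \<le> i" for i j x
    using that
  proof (induction j)
    case (Suc j)
    then have "i - j = Suc (i - Suc j)" by simp
    then show ?case using Suc by (simp add: VU)
  qed simp
  have UVn: "(U ^^ j) ((V ^^ i) x) = (V ^^ (i - j)) x" if "j \<le> i" for i j x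
    using that
  proof (induction j)
    case (Suc j)
    then have "i - j = Suc (i - Suc j)" by simp
    then show ?case using Suc by (simp add: UV)
  qed simp
  have UXn: "(U ^^ i) x \<in> X" if "x \<in> X" for i x
    using that by (induction i) (auto simp: UX)
  define b where "b = (LEAST j. (V ^^ j) x \<in> B)"
  define y where "y = (V ^^ b) x"
  have yB: "y \<in> B" unfolding y_def b_def using LeastI_ex[OF backward[OF x]] .
  have b_min: "(V ^^ j) x \<notin> B" if "j < b" for j
    using that not_less_Least unfolding b_def by blast
  have yX: "y \<in> X" using yB B by blast
  have xy: "x = (U ^^ b) y" using UVn[of b b x] by (simp add: y_def)
  define h where "h = Suc (LEAST h. (U ^^ Suc h) y \<in> B)"
  obtain j where j: "j \<le> N" "(U ^^ j) (U y) \<in> B" using forward[OF UX[OF yX]] by blast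
  then have jB: "(U ^^ Suc j) y \<in> B" by (simp add: funpow_swap1)
  have hB: "(U ^^ h) y \<in> B" unfolding h_def by (rule LeastI[of "\<lambda>h. (U ^^ Suc h) y \<in> B", OF jB])
  have hN: "h \<le> Suc N"
    unfolding h_def using Least_le[of "\<lambda>h. (U ^^ Suc h) y \<in> B", OF jB] j(1) by linarith
  have h_min: "(U ^^ i) y \<notin> B" if "0 < i" "i < h" for i
    using that not_less_Least[of "i - 1" "\<lambda>h. (U ^^ Suc h) y \<in> B"] unfolding h_def
    by (cases i) auto
  have bh: "b < h"
  proof (rule ccontr)
    assume "\<not> b < h"
    then have "(U ^^ h) y = (V ^^ (b - h)) x" "b - h < b"
      using UVn[of h b x] by (auto simp: y_def h_def)
    then show False using b_min hB by metis
  qed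
  have Si: "(S ^^ i) y = (U ^^ i) y" if "i < h" for i
    using that
  proof (induction i)
    case (Suc i)
    then have "(U ^^ Suc i) y \<notin> B" using h_min[of "Suc i"] by simp
    then show ?case using Suc S[OF UXn[OF yX, of i]] by simp
  qed simp
  \<comment> \<open>from the top level the map falls back to the base\<close>
  have Sh: "(S ^^ h) y = y"
  proof -
    define t where "t = h - 1"
    have h: "h = Suc t" by (simp add: t_def h_def)
    have "(LEAST j. (V ^^ j) ((U ^^ t) y) \<in> B) = t"
    proof (rule Least_equality)
      show "(V ^^ t) ((U ^^ t) y) \<in> B" using VUn[of t t y] yB by simp
      fix i assume i: "(V ^^ i) ((U ^^ t) y) \<in> B"
      show "t \<le> i"
      proof (rule ccontr)
        assume "\<not> t \<le> i"
        then show False using i VUn[of i t y] h_min[of "t - i"] h by simp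
      qed
    qed
    then have "S ((U ^^ t) y) = y"
      using S[OF UXn[OF yX, of t]] hB h VUn[of t t y] by simp
    then show ?thesis using Si[of t] h by simp
  qed
  have "(S ^^ h) x = (S ^^ h) ((S ^^ b) y)" using Si[OF bh] xy by simp
  also have "\<dots> = (S ^^ b) ((S ^^ h) y)" by (simp add: funpow_add[symmetric, THEN fun_cong, simplified o_def] add.commute)
  also have "\<dots> = x" using Sh Si[OF bh] xy by simp
  finally have Shx: "(S ^^ h) x = x" .
  have "h dvd fact (Suc N)" using hN by (intro dvd_fact) (auto simp: h_def)
  then obtain m where m: "fact (Suc N) = h * m" by (auto elim: dvdE)
  have "((S ^^ h) ^^ m) x = x" using Shx by (induction m) auto
  then show ?thesis unfolding m by (simp add: funpow_mult)
qed

section \<open>Uniform approximation by periodic maps\<close>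

text \<open>The measure algebra is countably generated and the points are separated by countably many
  sets, up to null sets. The Borel structure of the line serves as a fixed countably generated
  model.\<close>
locale separated_prob_space = prob_space M for M :: "'a measure" +
  fixes \<phi> :: "'a \<Rightarrow> real" and N :: "'a set"
  assumes \<phi>_measurable[measurable]: "\<phi> \<in> borel_measurable M"
    and N_null: "N \<in> null_sets M"
    and inj_\<phi>: "inj_on \<phi> (space M - N)"
    and generated: "\<And>E. E \<in> sets M \<Longrightarrow> \<exists>F\<in>sets borel. AE x in M. x \<in> E \<longleftrightarrow> \<phi> x \<in> F"
begin

lemma AE_not_N: "AE x in M. x \<notin> N" using N_null AE_not_in by blast

text \<open>The version is chosen such that \<open>\<phi>\<close> separates the different points of each orbit, without
  exceptional null set: off an invariant set \<open>Y\<close> all points are fixed, and on \<open>Y\<close> the function is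
  injective.\<close>
lemma total_version:
  assumes T: "T \<in> automorphisms M"
  obtains U V where "\<And>x. V (U x) = x" "\<And>x. U (V x) = x" "inverse_automorphisms M U V"
    "AE x in M. U x = T x"
    "\<And>x i. x \<in> space M \<Longrightarrow> \<phi> ((U ^^ i) x) = \<phi> x \<Longrightarrow> (U ^^ i) x = x"
proof -
  obtain R where TR: "inverse_automorphisms M T R" using T automorphisms_iff by metis
  then have T: "T \<in> M \<rightarrow>\<^sub>M M" and R: "R \<in> M \<rightarrow>\<^sub>M M"
    and dT: "distr M M T = M" and dR: "distr M M R = M"
    and RT: "\<And>x. x \<in> space M - N \<Longrightarrow> R (T x) = x" and TR: "\<And>x. x \<in> space M - N \<Longrightarrow> T (R x) = x"
    by (auto simp: inverse_automorphisms_def)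
  obtain U V Y where VU: "\<And>x. V (U x) = x" and UV: "\<And>x. U (V x) = x"
    and inv: "inverse_automorphisms M U V" and UT: "AE x in M. U x = T x"
    and YN: "Y \<subseteq> space M - N" and UY: "\<And>x. x \<in> Y \<Longrightarrow> U x \<in> Y" and U_id: "\<And>x. x \<notin> Y \<Longrightarrow> U x = x"
    by (rule invertible_version[OF T R dT dR N_null RT TR], assumption, assumption) (rule that)
  have "(U ^^ i) x = x" if x: "x \<in> space M" and eq: "\<phi> ((U ^^ i) x) = \<phi> x" for x i
  proof (cases "x \<in> Y")
    case True
    have "(U ^^ i) x \<in> Y" using True by (induction i) (auto simp: UY)
    then show ?thesis using True eq inj_\<phi> YN by (meson inj_onD subsetD)
  next
    case False
    then show ?thesis by (induction i) (auto simp: U_id)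
  qed
  then show thesis using that[of V U, OF VU UV inv UT] by simp
qed

text \<open>This is the uniform distance \<open>\<mu> {S \<noteq> T}\<close>. The set where \<open>S\<close> and \<open>T\<close> differ need not be
  measurable, but comparing the values of \<open>\<phi>\<close> changes it by a subset of a null set only.\<close>
definition discrepancy :: "('a \<Rightarrow> 'a) \<Rightarrow> ('a \<Rightarrow> 'a) \<Rightarrow> real" where
  "discrepancy S T = measure M {x \<in> space M. \<phi> (S x) \<noteq> \<phi> (T x)}"

lemma discrepancy_cong:
  assumes [measurable]: "S \<in> M \<rightarrow>\<^sub>M M" "S' \<in> M \<rightarrow>\<^sub>M M" "T \<in> M \<rightarrow>\<^sub>M M" "T' \<in> M \<rightarrow>\<^sub>M M"
    and "AE x in M. S x = S' x" "AE x in M. T x = T' x"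
  shows "discrepancy S T = discrepancy S' T'"
  unfolding discrepancy_def
proof (rule measure_eq_AE)
  show "AE x in M. x \<in> {x \<in> space M. \<phi> (S x) \<noteq> \<phi> (T x)} \<longleftrightarrow> x \<in> {x \<in> space M. \<phi> (S' x) \<noteq> \<phi> (T' x)}"
    using assms(5,6) by eventually_elim auto
qed measurable

text \<open>The periodic map \<open>S\<close> differs from \<open>T\<close> only at points about to enter \<open>B\<close> from a column that does
  not close up under \<open>T\<close>. Such a column has more than \<open>n\<close> levels, so the entry points \<open>B'\<close> have
  measure at most \<open>1 / (n + 1)\<close>.\<close>
theorem periodic_approximation:
  assumes T: "T \<in> automorphisms M" and e: "e > 0"
  obtains R q where "R \<in> automorphisms M" "q > 0" "\<And>x. x \<in> space M \<Longrightarrow> (R ^^ q) x = x"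
    "discrepancy T R < e"
proof -
  obtain U V where VU: "\<And>x. V (U x) = x" and UV: "\<And>x. U (V x) = x"
    and inv: "inverse_automorphisms M U V" and UT: "AE x in M. U x = T x"
    and sep: "\<And>x i. x \<in> space M \<Longrightarrow> \<phi> ((U ^^ i) x) = \<phi> x \<Longrightarrow> (U ^^ i) x = x"
    by (rule total_version[OF T]) (rule that)
  from inv have U[measurable]: "U \<in> M \<rightarrow>\<^sub>M M" and V[measurable]: "V \<in> M \<rightarrow>\<^sub>M M"
    and dU: "distr M M U = M" and dV: "distr M M V = M"
    by (auto simp: inverse_automorphisms_def)
  note Un[measurable] = measurable_funpow[OF U] and Vn[measurable] = measurable_funpow[OF V]
  have sp: "U x \<in> space M" "V x \<in> space M" "(U ^^ i) x \<in> space M" "(V ^^ i) x \<in> space M"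
    if "x \<in> space M" for x i
    using that measurable_space[OF U] measurable_space[OF V] measurable_space[OF Un]
      measurable_space[OF Vn] by auto
  have VUn: "(V ^^ i) ((U ^^ i) x) = x" and UVn: "(U ^^ i) ((V ^^ i) x) = x" for i x
    by (induction i arbitrary: x) (simp_all add: VU UV funpow_swap1)
  have UVj: "(U ^^ j) ((V ^^ i) x) = (V ^^ (i - j)) x" if "j \<le> i" for i j x
    using UVn[of j "(V ^^ (i - j)) x"] that funpow_add[of j "i - j" V] by simp
  have VUj: "(V ^^ j) ((U ^^ i) x) = (U ^^ (i - j)) x" if "j \<le> i" for i j x
    using VUn[of j "(U ^^ (i - j)) x"] that funpow_add[of j "i - j" U] by simp
  obtain n :: nat where n: "inverse (real (Suc n)) < e" using reals_Archimedean[OF e] by blast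
  obtain B where B[measurable]: "B \<in> sets M"
    and spaced0: "\<And>x i. x \<in> B \<Longrightarrow> i \<le> n \<Longrightarrow> (U ^^ i) x \<in> B \<Longrightarrow> \<phi> ((U ^^ i) x) = \<phi> x"
    and near: "\<And>x. x \<in> space M \<Longrightarrow> \<exists>i\<le>n. (U ^^ i) x \<in> B \<or> (V ^^ i) x \<in> B"
    by (rule spaced_sweeping_set[OF \<phi>_measurable U V VU UV, of n]) (rule that)
  have BM: "B \<subseteq> space M" using sets.sets_into_space[OF B] .
  have spaced: "(U ^^ i) x = x" if "x \<in> B" "i \<le> n" "(U ^^ i) x \<in> B" for x i
    using spaced0[OF that] sep[of x i] that BM by blast
  have backward: "\<exists>j. (V ^^ j) x \<in> B" if x: "x \<in> space M" for x
  proof -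
    obtain i where i: "i \<le> n" "(U ^^ i) ((V ^^ n) x) \<in> B \<or> (V ^^ i) ((V ^^ n) x) \<in> B"
      using near[OF sp(4)[OF x]] by blast
    then show ?thesis
      using UVj[OF i(1)] funpow_add[of i n V] by (metis comp_apply)
  qed
  have forward: "\<exists>j\<le>2 * n. (U ^^ j) x \<in> B" if x: "x \<in> space M" for x
  proof -
    obtain i where i: "i \<le> n" "(U ^^ i) ((U ^^ n) x) \<in> B \<or> (V ^^ i) ((U ^^ n) x) \<in> B"
      using near[OF sp(3)[OF x]] by blast
    then have "(U ^^ (i + n)) x \<in> B \<or> (U ^^ (n - i)) x \<in> B"
      using VUj[OF i(1)] funpow_add[of i n U] by auto
    moreover have "i + n \<le> 2 * n" "n - i \<le> 2 * n" using i(1) by auto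
    ultimately show ?thesis by blast
  qed
  define b where "b x = (LEAST j. (V ^^ j) x \<in> B)" for x
  \<comment> \<open>index of the branch used at \<open>x\<close>: \<open>0\<close> for a step of \<open>U\<close>, \<open>Suc j\<close> for \<open>j\<close> steps back to the base\<close>
  define c where "c x = (if U x \<in> B then Suc (b x) else 0)" for x
  define g h where "g j = (case j of 0 \<Rightarrow> U | Suc i \<Rightarrow> V ^^ i)"
    and "h j = (case j of 0 \<Rightarrow> V | Suc i \<Rightarrow> U ^^ i)" for j
  define S where "S = (\<lambda>x. g (c x) x)"
  have S_eq: "S x = (if U x \<in> B then (V ^^ b x) x else U x)" for x
    by (simp add: S_def g_def c_def)
  have b_meas[measurable]: "b \<in> M \<rightarrow>\<^sub>M count_space UNIV"
    unfolding b_def[abs_def] by measurable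
  have c_meas: "c \<in> M \<rightarrow>\<^sub>M count_space UNIV"
    unfolding c_def[abs_def] by measurable
  have gh: "inverse_automorphisms M (g j) (h j)" for j
    using dU dV by (cases j)
      (auto simp: g_def h_def VU UV UVn VUn distr_funpow intro!: inverse_automorphismsI)
  define q where "q = (fact (Suc (2 * n)) :: nat)"
  have q: "q > 0" by (simp add: q_def)
  have per: "(S ^^ q) x = x" if "x \<in> space M" for x
    unfolding q_def
    by (rule return_map_periodic[OF VU UV BM sp(1) backward forward _ that]) (simp_all add: S_eq b_def)
  have inj: "inj_on S (space M)"
  proof (rule inj_onI)
    fix x y assume "x \<in> space M" "y \<in> space M" "S x = S y"
    moreover have "(S ^^ q) z = (S ^^ (q - 1)) (S z)" for z
      using q by (cases q) (simp_all add: funpow_swap1)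
    ultimately show "x = y" using per by metis
  qed
  have S[measurable]: "S \<in> M \<rightarrow>\<^sub>M M" and dS: "distr M M S = M"
    using piecewise_preserving[OF c_meas gh] inj unfolding S_def by auto
  have aut: "S \<in> automorphisms M"
  proof -
    have "S ((S ^^ (q - 1)) x) = x" "(S ^^ (q - 1)) (S x) = x" if "x \<in> space M" for x
      using per[OF that] q by (cases q; simp add: funpow_swap1)+
    then have "inverse_automorphisms M S (S ^^ (q - 1))"
      using dS S by (intro inverse_automorphismsI measurable_funpow) auto
    then show ?thesis using automorphisms_iff by blast
  qed
  define B' where "B' = {y \<in> space M. y \<in> B \<and> (\<forall>i\<in>{1..n}. (V ^^ i) y \<notin> B)}"
  have B'[measurable]: "B' \<in> sets M" unfolding B'_def by measurable
  have diff: "U x \<in> B'" if x: "x \<in> space M" and ne: "S x \<noteq> U x" for x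
  proof -
    have y: "U x \<in> B" using ne by (auto simp: S_eq split: if_splits)
    have Sx: "S x = (V ^^ b x) x" using y by (simp add: S_eq)
    have SB: "S x \<in> B" unfolding Sx b_def using LeastI_ex[OF backward[OF x]] .
    have "(V ^^ i) (U x) \<notin> B" if i: "i \<in> {1..n}" for i
    proof
      assume a: "(V ^^ i) (U x) \<in> B"
      obtain j where j: "i = Suc j" using i by (cases i) auto
      then have "(V ^^ j) x \<in> B" using a by (simp add: funpow_swap1 VU)
      then have "b x \<le> j" unfolding b_def by (rule Least_le)
      then have "Suc (b x) \<le> n" using i j by simp
      moreover have "(U ^^ Suc (b x)) (S x) = U x" by (simp add: Sx UVn)
      ultimately show False using spaced[OF SB, of "Suc (b x)"] y ne by metis
    qed
    then show ?thesis using y sp(1)[OF x] by (simp add: B'_def)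
  qed
  \<comment> \<open>\<open>W i\<close> is the image of \<open>B'\<close> under \<open>U ^^ i\<close>; these \<open>n + 1\<close> disjoint sets have equal measure\<close>
  have small: "measure M B' \<le> inverse (real (Suc n))"
  proof -
    define W where "W i = {x \<in> space M. (V ^^ i) x \<in> B'}" for i
    have W[measurable]: "W i \<in> sets M" for i unfolding W_def by measurable
    have mW: "measure M (W i) = measure M B'" for i
      unfolding W_def using distr_preserves_measure[OF Vn distr_funpow[OF V dV] B'] .
    have disj: "W i \<inter> W j = {}" if "i < j" "j \<le> n" for i j
    proof (rule ccontr)
      assume "W i \<inter> W j \<noteq> {}"
      then obtain x where x: "(V ^^ i) x \<in> B'" "(V ^^ j) x \<in> B'" by (auto simp: W_def)
      have "(V ^^ j) x = (V ^^ (j - i)) ((V ^^ i) x)"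
        using that funpow_add[of "j - i" i V] by simp
      moreover have "j - i \<in> {1..n}" using that by auto
      ultimately show False using x unfolding B'_def by auto
    qed
    have "disjoint_family_on W {..n}"
      unfolding disjoint_family_on_def
      by (metis atMost_iff disj inf_commute linorder_neqE_nat)
    then have "measure M (\<Union>i\<le>n. W i) = (\<Sum>i\<le>n. measure M (W i))"
      by (intro finite_measure_finite_Union) auto
    then have "real (Suc n) * measure M B' \<le> 1" using mW prob_le_1[of "\<Union>i\<le>n. W i"] by simp
    then show ?thesis by (simp add: field_simps)
  qed
  have "discrepancy T S = discrepancy U S"
    using UT by (intro discrepancy_cong automorphism_measurable[OF T] U S) auto
  also have "\<dots> \<le> measure M {x \<in> space M. U x \<in> B'}"
    unfolding discrepancy_def by (rule finite_measure_mono) (use diff in force, measurable)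
  also have "\<dots> = measure M B'" by (rule distr_preserves_measure[OF U dU B'])
  finally show thesis using that[OF aut q per] small n by simp
qed

end

section \<open>Classes of automorphisms and the uniform distance\<close>

lemma automorphism_id: "(\<lambda>x. x) \<in> automorphisms M"
proof -
  have "inverse_automorphisms M (\<lambda>x. x) (\<lambda>x. x)"
    by (intro inverse_automorphismsI) (auto simp: distr_id)
  then show ?thesis using automorphisms_iff by blast
qed

lemma equiv_ae_equal: "equiv (automorphisms M) (ae_equal M)"
proof (rule equivI)
  show "refl_on (automorphisms M) (ae_equal M)" by (auto simp: refl_on_def ae_equal_def)
  show "ae_equal M \<subseteq> automorphisms M \<times> automorphisms M" by (auto simp: ae_equal_def)
  show "sym (ae_equal M)"
    by (rule symI) (auto simp: ae_equal_def elim: eventually_mono)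
  show "trans (ae_equal M)"
  proof (rule transI)
    fix R S T assume "(R, S) \<in> ae_equal M" "(S, T) \<in> ae_equal M"
    then have *: "R \<in> automorphisms M" "T \<in> automorphisms M"
      and ae: "AE x in M. R x = S x" "AE x in M. S x = T x" by (auto simp: ae_equal_def)
    from ae have "AE x in M. R x = T x" by eventually_elim simp
    with * show "(R, T) \<in> ae_equal M" by (simp add: ae_equal_def)
  qed
qed

lemma class_nonempty: "c \<in> automorphism_classes M \<Longrightarrow> c \<noteq> {}"
  unfolding automorphism_classes_def using equiv_ae_equal in_quotient_imp_non_empty by blast

lemma class_subset: "c \<in> automorphism_classes M \<Longrightarrow> T \<in> c \<Longrightarrow> T \<in> automorphisms M"
  unfolding automorphism_classes_def using equiv_ae_equal in_quotient_imp_subset by blast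

lemma class_AE_eq: "c \<in> automorphism_classes M \<Longrightarrow> S \<in> c \<Longrightarrow> T \<in> c \<Longrightarrow> AE x in M. S x = T x"
  unfolding automorphism_classes_def
  using in_quotient_imp_in_rel[OF equiv_ae_equal, of c M S T] by (auto simp: ae_equal_def)

definition class_of :: "'a measure \<Rightarrow> ('a \<Rightarrow> 'a) \<Rightarrow> ('a \<Rightarrow> 'a) set" where
  "class_of M T = ae_equal M `` {T}"

lemma class_of_in_classes: "T \<in> automorphisms M \<Longrightarrow> class_of M T \<in> automorphism_classes M"
  by (simp add: automorphism_classes_def class_of_def quotientI)

lemma in_class_of: "T \<in> automorphisms M \<Longrightarrow> T \<in> class_of M T"
  by (auto simp: class_of_def ae_equal_def)

lemma classes_eqI:
  assumes c: "c \<in> automorphism_classes M" "c' \<in> automorphism_classes M"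
    and ST: "S \<in> c" "T \<in> c'" and "AE x in M. S x = T x"
  shows "c = c'"
proof -
  have "(S, T) \<in> ae_equal M"
    using assms class_subset by (auto simp: ae_equal_def)
  then show ?thesis
    using quotient_eqI[OF equiv_ae_equal] c ST by (simp add: automorphism_classes_def)
qed

lemma AE_imp_null_set:
  assumes "AE x in M. P x"
  obtains Z where "Z \<in> null_sets M" "\<And>x. x \<in> space M - Z \<Longrightarrow> P x"
  using assms unfolding eventually_ae_filter by blast

text \<open>Automorphisms are strict bijections, while limit constructions give maps that are inverse to each
  other only almost everywhere.\<close>
lemma (in prob_space) AE_inverse_imp_automorphism:
  assumes T: "T \<in> M \<rightarrow>\<^sub>M M" and R: "R \<in> M \<rightarrow>\<^sub>M M"
    and dT: "distr M M T = M" and dR: "distr M M R = M"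
    and "AE x in M. R (T x) = x" "AE x in M. T (R x) = x"
  obtains S where "S \<in> automorphisms M" "AE x in M. S x = T x"
proof -
  have "AE x in M. R (T x) = x \<and> T (R x) = x" using assms(5,6) by eventually_elim simp
  then obtain Z where Z0: "Z \<in> null_sets M"
    and Z: "\<And>x. x \<in> space M - Z \<Longrightarrow> R (T x) = x \<and> T (R x) = x" using AE_imp_null_set by blast
  have "x \<in> space M - Z \<Longrightarrow> R (T x) = x" "x \<in> space M - Z \<Longrightarrow> T (R x) = x" for x
    using Z by blast+
  then obtain U V where "inverse_automorphisms M U V" "AE x in M. U x = T x"
    using invertible_version[OF T R dT dR Z0] by metis
  then show thesis using that automorphisms_iff by blast
qed

lemma (in prob_space) measure_tendsto_AE_eventually:
  assumes [measurable]: "\<And>k. A k \<in> sets M" "B \<in> sets M"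
    and ev: "AE x in M. eventually (\<lambda>k. x \<in> A k \<longleftrightarrow> x \<in> B) sequentially"
  shows "(\<lambda>k. measure M (A k)) \<longlonglongrightarrow> measure M B"
proof -
  have "(\<lambda>k. \<integral>x. indicat_real (A k) x \<partial>M) \<longlonglongrightarrow> (\<integral>x. indicat_real B x \<partial>M)"
  proof (rule integral_dominated_convergence[where w = "\<lambda>_. 1"])
    show "AE x in M. (\<lambda>k. indicat_real (A k) x) \<longlonglongrightarrow> indicat_real B x"
      using ev
    proof eventually_elim
      case (elim x)
      then show ?case
        by (intro tendsto_eventually) (auto elim!: eventually_mono simp: indicator_def)
    qed
  qed (auto simp: indicator_def)
  then show ?thesis by simp
qed

context separated_prob_space
begin

text \<open>Measure preservation is what keeps the images out of the null set on which \<open>\<phi>\<close> is not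
  injective.\<close>
lemma AE_eq_if_\<phi>_eq:
  assumes [measurable]: "S \<in> M \<rightarrow>\<^sub>M M" "T \<in> M \<rightarrow>\<^sub>M M" and "distr M M S = M" "distr M M T = M"
  shows "AE x in M. \<phi> (S x) = \<phi> (T x) \<longrightarrow> S x = T x"
proof -
  have "AE x in M. S x \<notin> N" "AE x in M. T x \<notin> N"
    using distr_preserves_AE AE_not_N assms by blast+
  then show ?thesis using AE_space
  proof eventually_elim
    case (elim x)
    then have "S x \<in> space M - N" "T x \<in> space M - N"
      using measurable_space[OF assms(1)] measurable_space[OF assms(2)] by auto
    then show ?case using inj_\<phi> by (meson inj_onD)
  qed
qed

lemma discrepancy_commute: "discrepancy S T = discrepancy T S"
  unfolding discrepancy_def by (rule arg_cong[where f = "measure M"]) auto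

lemma discrepancy_triangle:
  assumes [measurable]: "R \<in> M \<rightarrow>\<^sub>M M" "S \<in> M \<rightarrow>\<^sub>M M" "T \<in> M \<rightarrow>\<^sub>M M"
  shows "discrepancy R T \<le> discrepancy R S + discrepancy S T"
proof -
  have "discrepancy R T \<le>
      measure M ({x \<in> space M. \<phi> (R x) \<noteq> \<phi> (S x)} \<union> {x \<in> space M. \<phi> (S x) \<noteq> \<phi> (T x)})"
    unfolding discrepancy_def by (rule finite_measure_mono) (auto, measurable)
  also have "\<dots> \<le> discrepancy R S + discrepancy S T"
    unfolding discrepancy_def by (rule measure_Un_le) measurable
  finally show ?thesis .
qed

lemma discrepancy_eq_0_iff:
  assumes S: "S \<in> automorphisms M" and T: "T \<in> automorphisms M"
  shows "discrepancy S T = 0 \<longleftrightarrow> (AE x in M. S x = T x)"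
proof -
  note [measurable] = automorphism_measurable[OF S] automorphism_measurable[OF T]
  have "discrepancy S T = 0 \<longleftrightarrow> (AE x in M. \<phi> (S x) = \<phi> (T x))"
    unfolding discrepancy_def by (subst prob_Collect_eq_0) auto
  also have "\<dots> \<longleftrightarrow> (AE x in M. S x = T x)"
    using AE_eq_if_\<phi>_eq[of S T] automorphism_measurable[OF S] automorphism_measurable[OF T]
      automorphism_distr[OF S] automorphism_distr[OF T] by (auto elim: eventually_elim2)
  finally show ?thesis .
qed

text \<open>Substituting \<open>S x\<close> for \<open>x\<close>: if \<open>S x = T x\<close> then the two inverses agree at this point. Thus
  Cauchy sequences of maps have Cauchy sequences of inverses, and the limit is invertible.\<close>
lemma discrepancy_inverse_le:
  assumes S: "inverse_automorphisms M S S'" and T: "inverse_automorphisms M T T'"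
  shows "discrepancy S' T' \<le> discrepancy S T"
proof -
  have [measurable]: "S \<in> M \<rightarrow>\<^sub>M M" "S' \<in> M \<rightarrow>\<^sub>M M" "T \<in> M \<rightarrow>\<^sub>M M" "T' \<in> M \<rightarrow>\<^sub>M M"
    and d: "distr M M S = M" "distr M M T = M"
    and inv: "\<And>x. x \<in> space M \<Longrightarrow> S' (S x) = x" "\<And>x. x \<in> space M \<Longrightarrow> T' (T x) = x"
    using S T by (auto simp: inverse_automorphisms_def)
  define E where "E = {x \<in> space M. \<phi> (S' x) \<noteq> \<phi> (T' x)}"
  have [measurable]: "E \<in> sets M" unfolding E_def by measurable
  have "discrepancy S' T' = measure M {x \<in> space M. S x \<in> E}"
    using distr_preserves_measure[of S M E] d by (simp add: discrepancy_def E_def)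
  also have "\<dots> \<le> discrepancy S T"
    unfolding discrepancy_def
  proof (rule finite_measure_mono_AE)
    show "AE x in M. x \<in> {x \<in> space M. S x \<in> E} \<longrightarrow> x \<in> {x \<in> space M. \<phi> (S x) \<noteq> \<phi> (T x)}"
      using AE_eq_if_\<phi>_eq[OF \<open>S \<in> M \<rightarrow>\<^sub>M M\<close> \<open>T \<in> M \<rightarrow>\<^sub>M M\<close> d]
    proof eventually_elim
      case (elim x)
      show ?case using elim inv[of x] by (auto simp: E_def)
    qed
  qed measurable
  finally show ?thesis .
qed

lemma AE_eventually_constant:
  assumes T: "\<And>k. T k \<in> automorphisms M"
    and s: "summable (\<lambda>k. discrepancy (T k) (T (Suc k)))"
  shows "AE x in M. \<exists>m. \<forall>k\<ge>m. T k x = T m x"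
proof -
  have [measurable]: "T k \<in> M \<rightarrow>\<^sub>M M" for k using automorphism_measurable[OF T] .
  have "AE x in M. eventually (\<lambda>k. x \<in> space M - {x \<in> space M. \<phi> (T k x) \<noteq> \<phi> (T (Suc k) x)}) sequentially"
    using s unfolding discrepancy_def
    by (intro borel_cantelli_AE1) (auto simp: emeasure_eq_measure)
  moreover have "AE x in M. \<forall>k. \<phi> (T k x) = \<phi> (T (Suc k) x) \<longrightarrow> T k x = T (Suc k) x"
    unfolding AE_all_countable using AE_eq_if_\<phi>_eq automorphism_distr[OF T] by simp
  ultimately show ?thesis
  proof eventually_elim
    case (elim x)
    then obtain m where m: "\<And>k. k \<ge> m \<Longrightarrow> T k x = T (Suc k) x"
      by (auto simp: eventually_sequentially)
    have "T k x = T m x" if "k \<ge> m" for k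
      using that
    proof (induction k rule: dec_induct)
      case (step n) then show ?case using m[of n] by metis
    qed simp
    then show ?case by blast
  qed
qed

text \<open>Off a null set the maps and their inverses are eventually constant, and \<open>stable\<close> picks the
  eventual values. The two limits are inverse to each other almost everywhere because at a typical
  point both identities already hold for a late member of the sequence.\<close>
lemma limit_automorphism:
  assumes T: "\<And>k. T k \<in> automorphisms M"
    and s: "summable (\<lambda>k. discrepancy (T k) (T (Suc k)))"
  obtains S where "S \<in> automorphisms M" "(\<lambda>k. discrepancy (T k) S) \<longlonglongrightarrow> 0"
proof -
  have "\<forall>k. \<exists>R. inverse_automorphisms M (T k) R"
    using T automorphisms_iff by blast
  then obtain R where inv: "\<And>k. inverse_automorphisms M (T k) (R k)" by metis
  have RT: "R k (T k x) = x" "T k (R k x) = x" if "x \<in> space M" for k x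
    using inv[of k] that by (auto simp: inverse_automorphisms_def)
  have R: "R k \<in> automorphisms M" for k
    using inverse_automorphisms_sym[OF inv[of k]] automorphisms_iff by blast
  have Tm[measurable]: "T k \<in> M \<rightarrow>\<^sub>M M" and Rm[measurable]: "R k \<in> M \<rightarrow>\<^sub>M M" for k
    using automorphism_measurable T R by auto
  have sR: "summable (\<lambda>k. discrepancy (R k) (R (Suc k)))"
    by (rule summable_comparison_test'[OF s, of 0])
       (use discrepancy_inverse_le[OF inv inv] in \<open>simp add: discrepancy_def\<close>)
  have "AE x in M. (\<exists>m. \<forall>k\<ge>m. T k x = T m x) \<and> (\<exists>m. \<forall>k\<ge>m. R k x = R m x)"
    using AE_eventually_constant[OF T s] AE_eventually_constant[OF R sR] by eventually_elim simp
  from AE_imp_null_set[OF this] obtain Z where Z0: "Z \<in> null_sets M"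
    and Z: "\<And>x. x \<in> space M - Z \<Longrightarrow> (\<exists>m. \<forall>k\<ge>m. T k x = T m x) \<and> (\<exists>m. \<forall>k\<ge>m. R k x = R m x)" by blast
  have [measurable]: "Z \<in> sets M" using Z0 by auto
  define stable where "stable Q x = (if x \<in> space M - Z then
      Q (LEAST m. \<forall>k\<ge>m. Q k x = Q m x) x else x)" for Q :: "nat \<Rightarrow> 'a \<Rightarrow> 'a" and x
  have stable: "\<exists>m. \<forall>k\<ge>m. Q k x = stable Q x"
    if ex: "\<exists>m. \<forall>k\<ge>m. Q k x = Q m x" and x: "x \<in> space M - Z" for Q x
  proof -
    define l where "l = (LEAST m. \<forall>k\<ge>m. Q k x = Q m x)"
    have "\<forall>k\<ge>l. Q k x = Q l x"
      unfolding l_def using ex by (rule LeastI_ex[of "\<lambda>m. \<forall>k\<ge>m. Q k x = Q m x"])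
    moreover have "stable Q x = Q l x" using x by (simp add: stable_def l_def)
    ultimately show ?thesis by metis
  qed
  have stT: "\<exists>m. \<forall>k\<ge>m. T k x = stable T x" and stR: "\<exists>m. \<forall>k\<ge>m. R k x = stable R x"
    if "x \<in> space M - Z" for x
    using stable[of T x] stable[of R x] Z[OF that] that by simp_all
  have main: "stable Q \<in> M \<rightarrow>\<^sub>M M \<and> distr M M (stable Q) = M"
    if Q: "\<And>k. Q k \<in> automorphisms M"
      and st: "\<And>x. x \<in> space M - Z \<Longrightarrow> \<exists>m. \<forall>k\<ge>m. Q k x = stable Q x" for Q
  proof
    have Qm[measurable]: "Q k \<in> M \<rightarrow>\<^sub>M M" for k using automorphism_measurable Q by auto
    have sp: "stable Q x \<in> space M" if "x \<in> space M" for x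
      using that measurable_space[OF Qm] by (auto simp: stable_def)
    show m[measurable]: "stable Q \<in> M \<rightarrow>\<^sub>M M"
    proof (rule measurableI[OF sp])
      fix E assume [measurable]: "E \<in> sets M"
      have offZ: "stable Q x \<in> E \<longleftrightarrow> (\<exists>m. \<forall>k\<in>{m..}. Q k x \<in> E)" if x: "x \<in> space M - Z" for x
      proof -
        obtain m where m: "\<And>k. k \<ge> m \<Longrightarrow> Q k x = stable Q x" using st[OF x] by blast
        show ?thesis
        proof
          assume "\<exists>l. \<forall>k\<in>{l..}. Q k x \<in> E"
          then obtain l where "\<forall>k\<in>{l..}. Q k x \<in> E" by blast
          then have "Q (max l m) x \<in> E" by simp
          then show "stable Q x \<in> E" using m[of "max l m"] by simp
        qed (use m in \<open>auto intro!: exI[of _ m]\<close>)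
      qed
      have onZ: "stable Q x = x" if "x \<in> Z" for x using that by (simp add: stable_def)
      have "stable Q -` E \<inter> space M =
          {x \<in> space M. (x \<notin> Z \<and> (\<exists>m. \<forall>k\<in>{m..}. Q k x \<in> E)) \<or> (x \<in> Z \<and> x \<in> E)}"
      proof (rule set_eqI)
        fix x
        show "x \<in> stable Q -` E \<inter> space M \<longleftrightarrow> x \<in> {x \<in> space M.
            (x \<notin> Z \<and> (\<exists>m. \<forall>k\<in>{m..}. Q k x \<in> E)) \<or> (x \<in> Z \<and> x \<in> E)}"
          using offZ[of x] onZ[of x] by (cases "x \<in> Z") auto
      qed
      also have "\<dots> \<in> sets M" by measurable
      finally show "stable Q -` E \<inter> space M \<in> sets M" .
    qed
    show "distr M M (stable Q) = M"
    proof (rule measure_eqI)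
      fix E assume "E \<in> sets (distr M M (stable Q))"
      then have [measurable]: "E \<in> sets M" by simp
      have "(\<lambda>k. measure M {x \<in> space M. Q k x \<in> E}) \<longlonglongrightarrow> measure M {x \<in> space M. stable Q x \<in> E}"
      proof (rule measure_tendsto_AE_eventually)
        show "AE x in M. \<forall>\<^sub>F k in sequentially.
            (x \<in> {x \<in> space M. Q k x \<in> E}) = (x \<in> {x \<in> space M. stable Q x \<in> E})"
          using AE_not_in[OF Z0] AE_space
        proof eventually_elim
          case (elim x)
          then obtain m where "\<And>k. k \<ge> m \<Longrightarrow> Q k x = stable Q x" using st[of x] by blast
          then show ?case by (auto simp: eventually_sequentially intro!: exI[of _ m])
        qed
      qed measurable
      moreover have "measure M {x \<in> space M. Q k x \<in> E} = measure M E" for k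
        using distr_preserves_measure automorphism_distr Q Qm \<open>E \<in> sets M\<close> by blast
      ultimately have "measure M {x \<in> space M. stable Q x \<in> E} = measure M E"
        by (simp add: LIMSEQ_const_iff)
      then show "emeasure (distr M M (stable Q)) E = emeasure M E"
        by (simp add: emeasure_distr emeasure_eq_measure vimage_def Int_def conj_commute)
    qed simp
  qed
  have Tst[measurable]: "stable T \<in> M \<rightarrow>\<^sub>M M" and dTst: "distr M M (stable T) = M"
    using main[of T, OF T stT] by auto
  have Rst[measurable]: "stable R \<in> M \<rightarrow>\<^sub>M M" and dRst: "distr M M (stable R) = M"
    using main[of R, OF R stR] by auto
  have "AE x in M. stable T x \<notin> Z"
    by (rule distr_preserves_AE[OF Tst dTst AE_not_in[OF Z0]])
  then have ae1: "AE x in M. stable R (stable T x) = x" using AE_not_in[OF Z0] AE_space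
  proof eventually_elim
    case (elim x)
    obtain m where m: "\<forall>k\<ge>m. T k x = stable T x" using stT[of x] elim by auto
    have "stable T x \<in> space M - Z" using elim measurable_space[OF Tst] by auto
    then obtain l where "\<forall>k\<ge>l. R k (stable T x) = stable R (stable T x)" using stR by blast
    then have "stable R (stable T x) = R (max l m) (T (max l m) x)" using m by simp
    then show ?case using RT elim by simp
  qed
  have "AE x in M. stable R x \<notin> Z"
    by (rule distr_preserves_AE[OF Rst dRst AE_not_in[OF Z0]])
  then have ae2: "AE x in M. stable T (stable R x) = x" using AE_not_in[OF Z0] AE_space
  proof eventually_elim
    case (elim x)
    obtain m where m: "\<forall>k\<ge>m. R k x = stable R x" using stR[of x] elim by auto
    have "stable R x \<in> space M - Z" using elim measurable_space[OF Rst] by auto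
    then obtain l where "\<forall>k\<ge>l. T k (stable R x) = stable T (stable R x)" using stT by blast
    then have "stable T (stable R x) = T (max l m) (R (max l m) x)" using m by simp
    then show ?case using RT elim by simp
  qed
  obtain S where S: "S \<in> automorphisms M" and ST: "AE x in M. S x = stable T x"
    using AE_inverse_imp_automorphism[OF Tst Rst dTst dRst ae1 ae2] .
  have [measurable]: "S \<in> M \<rightarrow>\<^sub>M M" using automorphism_measurable[OF S] .
  have "(\<lambda>k. measure M {x \<in> space M. \<phi> (T k x) \<noteq> \<phi> (S x)}) \<longlonglongrightarrow> measure M {}"
  proof (rule measure_tendsto_AE_eventually)
    show "AE x in M. \<forall>\<^sub>F k in sequentially. (x \<in> {x \<in> space M. \<phi> (T k x) \<noteq> \<phi> (S x)}) = (x \<in> {})"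
      using AE_not_in[OF Z0] AE_space ST
    proof eventually_elim
      case (elim x)
      then obtain m where "\<And>k. k \<ge> m \<Longrightarrow> T k x = stable T x" using stT[of x] by blast
      then show ?case using elim by (auto simp: eventually_sequentially intro!: exI[of _ m])
    qed
  qed measurable
  then have "(\<lambda>k. discrepancy (T k) S) \<longlonglongrightarrow> 0" by (simp add: discrepancy_def)
  with S show thesis using that by blast
qed

definition class_dist :: "('a \<Rightarrow> 'a) set \<Rightarrow> ('a \<Rightarrow> 'a) set \<Rightarrow> real" where
  "class_dist c c' = discrepancy (SOME S. S \<in> c) (SOME T. T \<in> c')"

lemma class_dist_eq:
  assumes c: "c \<in> automorphism_classes M" "c' \<in> automorphism_classes M" and ST: "S \<in> c" "T \<in> c'"
  shows "class_dist c c' = discrepancy S T"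
proof -
  define S' T' where "S' = (SOME S. S \<in> c)" and "T' = (SOME T. T \<in> c')"
  have "S' \<in> c" unfolding S'_def by (rule someI[of "\<lambda>S. S \<in> c", OF ST(1)])
  moreover have "T' \<in> c'" unfolding T'_def by (rule someI[of "\<lambda>T. T \<in> c'", OF ST(2)])
  ultimately have "discrepancy S' T' = discrepancy S T"
    by (intro discrepancy_cong automorphism_measurable class_subset[OF c(1)] class_subset[OF c(2)]
        class_AE_eq[OF c(1)] class_AE_eq[OF c(2)] ST)
  then show ?thesis by (simp add: class_dist_def S'_def T'_def)
qed

sublocale class_metric: Metric_space "automorphism_classes M" class_dist
proof
  show "0 \<le> class_dist c c'" for c c' by (simp add: class_dist_def discrepancy_def)
  show "class_dist c c' = class_dist c' c" for c c'
    by (simp add: class_dist_def discrepancy_commute)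
next
  fix c c' assume c: "c \<in> automorphism_classes M" "c' \<in> automorphism_classes M"
  obtain S T where ST: "S \<in> c" "T \<in> c'"
    using class_nonempty[OF c(1)] class_nonempty[OF c(2)] by blast
  have "class_dist c c' = 0 \<longleftrightarrow> (AE x in M. S x = T x)"
    using class_dist_eq[OF c ST] discrepancy_eq_0_iff[OF class_subset[OF c(1) ST(1)] class_subset[OF c(2) ST(2)]]
    by simp
  also have "\<dots> \<longleftrightarrow> c = c'"
    using classes_eqI[OF c ST] class_AE_eq[OF c(1) ST(1)] ST(2) by blast
  finally show "class_dist c c' = 0 \<longleftrightarrow> c = c'" .
next
  fix c c' c'' assume c: "c \<in> automorphism_classes M" "c' \<in> automorphism_classes M"
    "c'' \<in> automorphism_classes M"
  obtain R S T where *: "R \<in> c" "S \<in> c'" "T \<in> c''"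
    using class_nonempty[OF c(1)] class_nonempty[OF c(2)] class_nonempty[OF c(3)] by blast
  then have "R \<in> M \<rightarrow>\<^sub>M M" "S \<in> M \<rightarrow>\<^sub>M M" "T \<in> M \<rightarrow>\<^sub>M M"
    using class_subset[OF c(1)] class_subset[OF c(2)] class_subset[OF c(3)] automorphism_measurable
    by blast+
  from discrepancy_triangle[OF this]
  show "class_dist c c'' \<le> class_dist c c' + class_dist c' c''"
    by (simp add: class_dist_eq[OF c(1,2) *(1,2)] class_dist_eq[OF c(2,3) *(2,3)] class_dist_eq[OF c(1,3) *(1,3)])
qed

text \<open>A Cauchy sequence has a subsequence whose successive distances are dominated by a geometric
  series, to which the preceding limit construction applies.\<close>
lemma mcomplete_classes: "class_metric.mcomplete"
  unfolding class_metric.mcomplete_def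
proof (intro allI impI)
  fix \<sigma> assume \<sigma>: "class_metric.MCauchy \<sigma>"
  then have \<sigma>c: "\<sigma> n \<in> automorphism_classes M" for n by (auto simp: class_metric.MCauchy_def)
  have "\<exists>L. \<forall>n\<ge>L. \<forall>n'\<ge>L. class_dist (\<sigma> n) (\<sigma> n') < (1/2) ^ k" for k :: nat
    using \<sigma> unfolding class_metric.MCauchy_def by (meson zero_less_power half_gt_zero zero_less_one)
  then obtain L where L: "\<And>k n n'. n \<ge> L k \<Longrightarrow> n' \<ge> L k \<Longrightarrow> class_dist (\<sigma> n) (\<sigma> n') < (1/2) ^ k"
    by metis
  \<comment> \<open>the summand \<open>k\<close> makes \<open>r\<close> strictly increasing\<close>
  define r where "r k = (\<Sum>i\<le>k. L i) + k" for k :: nat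
  have r: "strict_mono r" by (rule strict_mono_Suc_iff[THEN iffD2]) (simp add: r_def)
  have rL: "r k \<ge> L k" for k using member_le_sum[of k "{..k}" L] by (simp add: r_def)
  have rL': "r (Suc k) \<ge> L k" for k
    using rL[of k] strict_mono_less_eq[OF r, of k "Suc k"] by simp
  define T where "T k = (SOME T. T \<in> \<sigma> (r k))" for k
  have T: "T k \<in> \<sigma> (r k)" for k
    unfolding T_def using class_nonempty[OF \<sigma>c] by (simp add: some_in_eq)
  have Ta: "T k \<in> automorphisms M" for k using class_subset[OF \<sigma>c T] .
  have "discrepancy (T k) (T (Suc k)) \<le> (1/2) ^ k" for k
    using L[OF rL rL', of k] class_dist_eq[OF \<sigma>c \<sigma>c T T] by (metis less_imp_le)
  then have "summable (\<lambda>k. discrepancy (T k) (T (Suc k)))"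
    by (intro summable_comparison_test'[OF summable_geometric[of "1/2 :: real"], of 0])
       (auto simp: discrepancy_def)
  from limit_automorphism[OF Ta this]
  obtain S where S: "S \<in> automorphisms M" and lim: "(\<lambda>k. discrepancy (T k) S) \<longlonglongrightarrow> 0" .
  have "class_dist (\<sigma> (r k)) (class_of M S) = discrepancy (T k) S" for k
    using class_dist_eq[OF \<sigma>c class_of_in_classes[OF S] T in_class_of[OF S]] .
  then have "limitin class_metric.mtopology (\<sigma> \<circ> r) (class_of M S) sequentially"
    using lim \<sigma>c class_of_in_classes[OF S]
    by (simp add: class_metric.limitin_metric_dist_null)
  then show "\<exists>c. limitin class_metric.mtopology \<sigma> c sequentially"
    using class_metric.MCauchy_convergent_subsequence[OF \<sigma> r] by blast
qed

end

section \<open>The uniform distance refines the weak topology\<close>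

text \<open>Uniform integrability of the single function \<open>h\<close>; in this form it survives composition with any
  measure preserving map, with the same constant \<open>K\<close>.\<close>
lemma (in prob_space) truncation_small:
  fixes h :: "'a \<Rightarrow> real"
  assumes h: "integrable M h" and nn: "\<And>x. h x \<ge> 0" and e: "\<eta> > 0"
  obtains K where "K > 0" "(\<integral>x. max 0 (h x - K) \<partial>M) < \<eta>"
proof -
  have [measurable]: "h \<in> borel_measurable M" using h by auto
  have "(\<lambda>k. \<integral>x. max 0 (h x - real k) \<partial>M) \<longlonglongrightarrow> (\<integral>x. 0 \<partial>M)"
  proof (rule integral_dominated_convergence[where w = h])
    show "AE x in M. (\<lambda>k. max 0 (h x - real k)) \<longlonglongrightarrow> 0"
    proof (rule AE_I2)
      fix x
      obtain m where m: "h x \<le> real m" using real_arch_simple by blast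
      show "(\<lambda>k. max 0 (h x - real k)) \<longlonglongrightarrow> 0"
        by (rule tendsto_eventually) (use m in \<open>auto simp: eventually_sequentially intro!: exI[of _ m]\<close>)
    qed
    show "AE x in M. norm (max 0 (h x - real k)) \<le> h x" for k using nn by simp
  qed (use h in auto)
  then have "\<forall>\<^sub>F k in sequentially. (\<integral>x. max 0 (h x - real k) \<partial>M) < \<eta>"
    using e by (intro order_tendstoD(2)) auto
  then obtain k where k: "\<And>l. l \<ge> k \<Longrightarrow> (\<integral>x. max 0 (h x - real l) \<partial>M) < \<eta>"
    by (auto simp: eventually_sequentially)
  show thesis by (rule that[of "real (Suc k)"]) (use k[of "Suc k"] in auto)
qed

lemma (in prob_space) integral_preserved:
  fixes h :: "'a \<Rightarrow> real"
  assumes S: "S \<in> automorphisms M" and h: "h \<in> borel_measurable M"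
  shows "integrable M h \<Longrightarrow> integrable M (\<lambda>x. h (S x))" "(\<integral>x. h (S x) \<partial>M) = (\<integral>x. h x \<partial>M)"
  using integrable_distr_eq[OF automorphism_measurable[OF S] h]
    integral_distr[OF automorphism_measurable[OF S] h] automorphism_distr[OF S] by simp_all

lemma (in prob_space) integral_small_set_le:
  fixes h :: "'a \<Rightarrow> real"
  assumes S: "S \<in> automorphisms M" and h: "integrable M h" and nn: "\<And>x. h x \<ge> 0"
    and K: "K > 0" and D[measurable]: "D \<in> sets M"
  shows "integrable M (\<lambda>x. indicat_real D x * h (S x))"
    "(\<integral>x. indicat_real D x * h (S x) \<partial>M) \<le> K * measure M D + (\<integral>x. max 0 (h x - K) \<partial>M)"
proof -
  have [measurable]: "h \<in> borel_measurable M" "S \<in> M \<rightarrow>\<^sub>M M"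
    using h automorphism_measurable[OF S] by auto
  have i1: "integrable M (\<lambda>x. h (S x))" using integral_preserved(1)[OF S _ h] by simp
  show i2: "integrable M (\<lambda>x. indicat_real D x * h (S x))"
    by (rule Bochner_Integration.integrable_bound[OF i1]) (auto simp: indicator_def nn)
  have i3: "integrable M (\<lambda>x. max 0 (h x - K))"
    by (rule Bochner_Integration.integrable_bound[OF h]) (use nn K in \<open>auto simp: max_def\<close>)
  then have i4: "integrable M (\<lambda>x. max 0 (h (S x) - K))"
    by (rule integral_preserved(1)[OF S, rotated]) simp
  have iD: "integrable M (\<lambda>x. K * indicat_real D x)"
    by (intro integrable_mult_right integrable_real_indicator D) (simp add: emeasure_eq_measure)
  have "(\<integral>x. indicat_real D x * h (S x) \<partial>M) \<le> (\<integral>x. K * indicat_real D x + max 0 (h (S x) - K) \<partial>M)"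
    by (rule integral_mono[OF i2 Bochner_Integration.integrable_add[OF iD i4]])
       (simp add: indicator_def max_def)
  also have "\<dots> = K * measure M D + (\<integral>x. max 0 (h (S x) - K) \<partial>M)"
    by (subst Bochner_Integration.integral_add[OF iD i4]) simp
  also have "(\<integral>x. max 0 (h (S x) - K) \<partial>M) = (\<integral>x. max 0 (h x - K) \<partial>M)"
    using integral_preserved(2)[OF S, of "\<lambda>x. max 0 (h x - K)"] by simp
  finally show "(\<integral>x. indicat_real D x * h (S x) \<partial>M) \<le> K * measure M D + (\<integral>x. max 0 (h x - K) \<partial>M)" .
qed

lemma cmod_diff_sq_le: "(cmod (a - b))\<^sup>2 \<le> 2 * (cmod a)\<^sup>2 + 2 * (cmod b)\<^sup>2"
proof -
  have "(cmod (a - b))\<^sup>2 \<le> (cmod a + cmod b)\<^sup>2"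
    by (rule power_mono[OF norm_triangle_ineq4]) simp
  also have "\<dots> \<le> 2 * (cmod a)\<^sup>2 + 2 * (cmod b)\<^sup>2"
    using sum_squares_bound[of "cmod a" "cmod b"] by (simp add: power2_sum)
  finally show ?thesis .
qed

lemma l2_norm_less_iff: "\<epsilon> > 0 \<Longrightarrow> l2_norm M f < \<epsilon> \<longleftrightarrow> (\<integral>x. (cmod (f x))\<^sup>2 \<partial>M) < \<epsilon>\<^sup>2"
  unfolding l2_norm_def using real_sqrt_less_iff[of _ "\<epsilon>\<^sup>2"] by simp

text \<open>The sets that generate \<^const>\<open>weak_topology\<close>.\<close>
definition weak_subbasic :: "'a measure \<Rightarrow> ('a \<Rightarrow> 'a) \<Rightarrow> ('a \<Rightarrow> complex) \<Rightarrow> real \<Rightarrow> ('a \<Rightarrow> 'a) set set" where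
  "weak_subbasic M T f \<epsilon> = {c \<in> automorphism_classes M.
     \<forall>S\<in>c. l2_norm M (\<lambda>x. koopman S f x - koopman T f x) < \<epsilon>}"

lemma weak_topology_eq:
  "weak_topology M = topology_generated_by
     {weak_subbasic M T f \<epsilon> | T f \<epsilon>. T \<in> automorphisms M \<and> f \<in> square_integrable M \<and> \<epsilon> > 0}"
  by (simp add: weak_topology_def weak_subbasic_def)

lemma openin_weak_subbasic:
  assumes "T \<in> automorphisms M" "f \<in> square_integrable M" "\<epsilon> > 0"
  shows "openin (weak_topology M) (weak_subbasic M T f \<epsilon>)"
  unfolding weak_topology_eq by (rule topology_generated_by_Basis) (use assms in blast)

lemma topspace_weak_topology: "topspace (weak_topology M) = automorphism_classes M"
proof
  show "topspace (weak_topology M) \<subseteq> automorphism_classes M"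
    unfolding weak_topology_eq topology_generated_by_topspace by (auto simp: weak_subbasic_def)
  have "(\<lambda>x. 0) \<in> square_integrable M" by (simp add: square_integrable_def)
  then have "openin (weak_topology M) (weak_subbasic M (\<lambda>x. x) (\<lambda>x. 0) 1)"
    by (intro openin_weak_subbasic automorphism_id) auto
  moreover have "weak_subbasic M (\<lambda>x. x) (\<lambda>x. 0) 1 = automorphism_classes M"
    by (auto simp: weak_subbasic_def l2_norm_def koopman_def)
  ultimately show "automorphism_classes M \<subseteq> topspace (weak_topology M)"
    using openin_subset by metis
qed

context separated_prob_space
begin

text \<open>If \<open>S'\<close> equals \<open>S\<close> off a set \<open>D\<close>, then passing from \<open>S\<close> to \<open>S'\<close> changes the integrand only on
  \<open>D\<close>, where it is bounded by \<open>2 * h (S' x) + 2 * h (T x)\<close> with \<open>h = |f|\<^sup>2\<close>. These terms are uniformly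
  integrable over all automorphisms, so a small measure of \<open>D\<close> suffices.\<close>
lemma openin_metric_weak_subbasic:
  assumes T: "T \<in> automorphisms M" and f: "f \<in> square_integrable M" and \<epsilon>: "\<epsilon> > 0"
  shows "openin class_metric.mtopology (weak_subbasic M T f \<epsilon>)"
  unfolding class_metric.openin_mtopology
proof (intro conjI allI impI)
  show "weak_subbasic M T f \<epsilon> \<subseteq> automorphism_classes M" by (auto simp: weak_subbasic_def)
  fix c assume c: "c \<in> weak_subbasic M T f \<epsilon>"
  then have cc: "c \<in> automorphism_classes M" by (simp add: weak_subbasic_def)
  obtain S where Sc: "S \<in> c" using class_nonempty[OF cc] by blast
  have S: "S \<in> automorphisms M" using class_subset[OF cc Sc] .
  define h where "h x = (cmod (f x))\<^sup>2" for x
  have fm[measurable]: "f \<in> borel_measurable M" and h: "integrable M h"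
    using f by (auto simp: square_integrable_def h_def[abs_def])
  have hm[measurable]: "h \<in> borel_measurable M" using h by auto
  have hn: "h x \<ge> 0" for x by (simp add: h_def)
  define I where "I S = (\<integral>x. (cmod (f (S x) - f (T x)))\<^sup>2 \<partial>M)" for S
  have I: "l2_norm M (\<lambda>x. koopman S f x - koopman T f x) < \<epsilon> \<longleftrightarrow> I S < \<epsilon>\<^sup>2" for S
    using l2_norm_less_iff[OF \<epsilon>] by (simp add: I_def koopman_def)
  have "I S < \<epsilon>\<^sup>2" using c Sc I by (simp add: weak_subbasic_def)
  \<comment> \<open>\<open>D\<close> contributes less than \<open>2 * 2\<eta> + 2 * 2\<eta>\<close>\<close>
  define \<eta> where "\<eta> = (\<epsilon>\<^sup>2 - I S) / 8"
  have \<eta>: "\<eta> > 0" using \<open>I S < \<epsilon>\<^sup>2\<close> by (simp add: \<eta>_def)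
  obtain K where K: "K > 0" and Ks: "(\<integral>x. max 0 (h x - K) \<partial>M) < \<eta>"
    using truncation_small[OF h hn \<eta>] .
  define r where "r = \<eta> / K"
  have r: "r > 0" using \<eta> K by (simp add: r_def)
  have "class_metric.mball c r \<subseteq> weak_subbasic M T f \<epsilon>"
  proof
    fix c' assume c': "c' \<in> class_metric.mball c r"
    then have cc': "c' \<in> automorphism_classes M" and d: "class_dist c c' < r" by auto
    have "I S' < \<epsilon>\<^sup>2" if S'c: "S' \<in> c'" for S'
    proof -
      have S': "S' \<in> automorphisms M" using class_subset[OF cc' S'c] .
      have [measurable]: "S \<in> M \<rightarrow>\<^sub>M M" "S' \<in> M \<rightarrow>\<^sub>M M" "T \<in> M \<rightarrow>\<^sub>M M"
        using automorphism_measurable S S' T by auto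
      define D where "D = {x \<in> space M. \<phi> (S x) \<noteq> \<phi> (S' x)}"
      have D[measurable]: "D \<in> sets M" unfolding D_def by measurable
      have mD: "measure M D < r"
        using d class_dist_eq[OF cc cc' Sc S'c] by (simp add: D_def discrepancy_def)
      have hi: "integrable M (\<lambda>x. h (Q x))" if "Q \<in> automorphisms M" for Q
        using integral_preserved(1)[OF that hm h] .
      have di: "integrable M (\<lambda>x. (cmod (f (Q x) - f (T x)))\<^sup>2)" if Q: "Q \<in> automorphisms M" for Q
      proof (rule Bochner_Integration.integrable_bound)
        show "integrable M (\<lambda>x. 2 * h (Q x) + 2 * h (T x))" using hi Q T by auto
        have [measurable]: "Q \<in> M \<rightarrow>\<^sub>M M" using automorphism_measurable Q by auto
        show "(\<lambda>x. (cmod (f (Q x) - f (T x)))\<^sup>2) \<in> borel_measurable M" by measurable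
        show "AE x in M. norm ((cmod (f (Q x) - f (T x)))\<^sup>2) \<le> norm (2 * h (Q x) + 2 * h (T x))"
          using cmod_diff_sq_le by (auto simp: h_def)
      qed
      define J where "J Q = (\<integral>x. indicat_real D x * h (Q x) \<partial>M)" for Q
      have Ji: "integrable M (\<lambda>x. indicat_real D x * h (Q x))" and J: "J Q < 2 * \<eta>"
        if Q: "Q \<in> automorphisms M" for Q
      proof -
        show "integrable M (\<lambda>x. indicat_real D x * h (Q x))"
          by (rule integral_small_set_le(1)[OF Q h hn K D])
        have "J Q \<le> K * measure M D + (\<integral>x. max 0 (h x - K) \<partial>M)"
          unfolding J_def by (rule integral_small_set_le(2)[OF Q h hn K D])
        also have "K * measure M D \<le> \<eta>" using mD K by (simp add: r_def field_simps)
        finally show "J Q < 2 * \<eta>" using Ks by simp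
      qed
      have "I S' \<le> (\<integral>x. (cmod (f (S x) - f (T x)))\<^sup>2 +
          (2 * (indicat_real D x * h (S' x)) + 2 * (indicat_real D x * h (T x))) \<partial>M)"
        unfolding I_def
      proof (rule integral_mono_AE)
        have "AE x in M. \<phi> (S x) = \<phi> (S' x) \<longrightarrow> S x = S' x"
          by (rule AE_eq_if_\<phi>_eq) (use automorphism_distr S S' in auto)
        then show "AE x in M. (cmod (f (S' x) - f (T x)))\<^sup>2 \<le> (cmod (f (S x) - f (T x)))\<^sup>2 +
          (2 * (indicat_real D x * h (S' x)) + 2 * (indicat_real D x * h (T x)))"
          using AE_space
        proof eventually_elim
          case (elim x)
          show ?case
          proof (cases "x \<in> D")
            case True
            then show ?thesis using cmod_diff_sq_le[of "f (S' x)" "f (T x)"] by (simp add: h_def add_increasing)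
          next
            case False
            then show ?thesis using elim by (simp add: D_def)
          qed
        qed
      qed (intro Bochner_Integration.integrable_add integrable_mult_right di Ji S S' T)+
      also have "\<dots> = I S + (2 * J S' + 2 * J T)"
        unfolding I_def J_def using di[OF S] Ji[OF S'] Ji[OF T] by simp
      also have "\<dots> < \<epsilon>\<^sup>2"
        using J[OF S'] J[OF T] by (simp add: \<eta>_def field_simps)
      finally show ?thesis .
    qed
    then show "c' \<in> weak_subbasic M T f \<epsilon>" using cc' I by (simp add: weak_subbasic_def)
  qed
  with r show "\<exists>r>0. class_metric.mball c r \<subseteq> weak_subbasic M T f \<epsilon>" by blast
qed

lemma weak_open_imp_metric_open:
  assumes "openin (weak_topology M) W"
  shows "openin class_metric.mtopology W"
proof -
  have "generate_topology_on
      {weak_subbasic M T f \<epsilon> | T f \<epsilon>. T \<in> automorphisms M \<and> f \<in> square_integrable M \<and> \<epsilon> > 0} W"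
    using assms by (simp add: weak_topology_eq openin_topology_generated_by_iff)
  then show ?thesis
  proof induction
    case (UN \<K>) then show ?case by (intro openin_Union) auto
  next
    case (Basis s) then show ?case using openin_metric_weak_subbasic by auto
  qed (auto intro: openin_Int)
qed

end

section \<open>A countable dense family of sets\<close>

context separated_prob_space
begin

text \<open>By outer regularity on the line a Borel set is close to an open set, which is an increasing limit
  of finite unions of basic sets.\<close>
lemma borel_approximation:
  assumes \<B>: "topological_basis \<B>" "countable \<B>" and F: "F \<in> sets borel" and e: "\<eta> > 0"
  obtains \<K> where "finite \<K>" "\<K> \<subseteq> \<B>" "measure M (sym_diff {x \<in> space M. \<phi> x \<in> F} {x \<in> space M. \<phi> x \<in> \<Union>\<K>}) < \<eta>"
proof -
  define \<nu> where "\<nu> = distr M borel \<phi>"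
  interpret \<nu>: prob_space \<nu> unfolding \<nu>_def by (rule prob_space_distr) simp
  have s\<nu>[measurable_cong, simp]: "sets \<nu> = sets borel" by (simp add: \<nu>_def)
  have m\<nu>: "measure \<nu> A = measure M {x \<in> space M. \<phi> x \<in> A}" if "A \<in> sets borel" for A
    using that by (simp add: \<nu>_def measure_distr vimage_def Int_def conj_commute)
  have "emeasure \<nu> F = (INF U \<in> {U. F \<subseteq> U \<and> open U}. emeasure \<nu> U)"
    by (rule outer_regular) (use F in auto)
  then have "(INF U \<in> {U. F \<subseteq> U \<and> open U}. emeasure \<nu> U) < emeasure \<nu> F + ennreal (\<eta> / 2)"
  proof (rule ord_eq_less_trans[OF sym])
    show "emeasure \<nu> F < emeasure \<nu> F + ennreal (\<eta> / 2)"
      using e by (simp add: \<nu>.emeasure_eq_measure ennreal_less_iff flip: ennreal_plus)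
  qed
  then obtain U where U: "F \<subseteq> U" "open U" "emeasure \<nu> U < emeasure \<nu> F + ennreal (\<eta> / 2)"
    by (auto simp: INF_less_iff)
  have Um[measurable]: "U \<in> sets borel" using U by simp
  note F[measurable]
  have mU: "measure \<nu> U < measure \<nu> F + \<eta> / 2"
    using U(3) e by (simp add: \<nu>.emeasure_eq_measure ennreal_less_iff flip: ennreal_plus)
  obtain \<K> where \<K>: "\<K> \<subseteq> \<B>" "U = \<Union>\<K>"
    using \<B>(1) U(2) unfolding topological_basis_def by metis
  have c\<K>: "countable \<K>" using \<K>(1) \<B>(2) countable_subset by blast
  show thesis
  proof (cases "\<K> = {}")
    case True
    then show thesis using \<K> U(1) e by (intro that[of "{}"]) auto
  next
    case False
    define G where "G n = (\<Union>i\<le>n. from_nat_into \<K> i)" for n :: nat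
    have Go: "open (G n)" for n
      unfolding G_def using from_nat_into[OF False] \<K>(1) topological_basis_open[OF \<B>(1)]
      by (intro open_UN) blast
    have Gm[measurable]: "G n \<in> sets borel" for n using Go by simp
    have GU: "(\<Union>n. G n) = U"
    proof -
      have "from_nat_into \<K> i \<subseteq> G i" for i by (auto simp: G_def)
      then have "(\<Union>n. G n) = \<Union>(range (from_nat_into \<K>))" by (auto simp: G_def)
      then show ?thesis using range_from_nat_into[OF False c\<K>] \<K>(2) by simp
    qed
    have "incseq G" by (force simp: incseq_def G_def)
    then have "(\<lambda>n. measure \<nu> (G n)) \<longlonglongrightarrow> measure \<nu> U"
      using \<nu>.finite_Lim_measure_incseq[of G] GU Gm by (simp add: image_subset_iff)
    then have "\<forall>\<^sub>F n in sequentially. measure \<nu> U - \<eta> / 2 < measure \<nu> (G n)"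
      using e by (intro order_tendstoD(1)) auto
    then obtain n where n: "measure \<nu> U - \<eta> / 2 < measure \<nu> (G n)"
      by (metis eventually_sequentially order_refl)
    have GnU: "G n \<subseteq> U" using GU by blast
    have "measure \<nu> (sym_diff F (G n)) \<le> measure \<nu> ((U - F) \<union> (U - G n))"
      using U(1) GnU by (intro \<nu>.finite_measure_mono) auto
    also have "\<dots> \<le> measure \<nu> (U - F) + measure \<nu> (U - G n)"
      by (rule measure_Un_le) auto
    also have "\<dots> = measure \<nu> U - measure \<nu> F + (measure \<nu> U - measure \<nu> (G n))"
      using U(1) GnU by (simp add: \<nu>.finite_measure_Diff)
    also have "\<dots> < \<eta>" using mU n by simp
    finally have "measure M {x \<in> space M. \<phi> x \<in> sym_diff F (G n)} < \<eta>"
      by (simp add: m\<nu>)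
    moreover have "{x \<in> space M. \<phi> x \<in> sym_diff F (G n)} =
        sym_diff {x \<in> space M. \<phi> x \<in> F} {x \<in> space M. \<phi> x \<in> \<Union>(from_nat_into \<K> ` {..n})}"
      by (auto simp: G_def)
    moreover have "from_nat_into \<K> ` {..n} \<subseteq> \<B>" using from_nat_into[OF False] \<K>(1) by blast
    ultimately show thesis by (intro that[of "from_nat_into \<K> ` {..n}"]) auto
  qed
qed

lemma countable_dense_sets:
  obtains A :: "nat \<Rightarrow> 'a set" where "\<And>k. A k \<in> sets M"
    "\<And>E \<eta>. E \<in> sets M \<Longrightarrow> \<eta> > 0 \<Longrightarrow> \<exists>k. measure M (sym_diff E (A k)) < \<eta>"
proof -
  obtain \<B> :: "real set set" where \<B>: "countable \<B>" "topological_basis \<B>"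
    using ex_countable_basis by blast
  define \<A> where "\<A> = (\<lambda>\<K>. {x \<in> space M. \<phi> x \<in> \<Union>\<K>}) ` {\<K>. finite \<K> \<and> \<K> \<subseteq> \<B>}"
  have c: "countable \<A>"
    unfolding \<A>_def by (intro countable_image countable_Collect_finite_subset \<B>)
  have ne: "\<A> \<noteq> {}" by (auto simp: \<A>_def)
  have sets: "E \<in> sets M" if E: "E \<in> \<A>" for E
  proof -
    obtain \<K> where \<K>: "\<K> \<subseteq> \<B>" "E = {x \<in> space M. \<phi> x \<in> \<Union>\<K>}"
      using E unfolding \<A>_def by blast
    have "open (\<Union>\<K>)" using \<K>(1) topological_basis_open[OF \<B>(2)] by (intro open_Union) blast
    then have [measurable]: "\<Union>\<K> \<in> sets borel" by simp
    show ?thesis unfolding \<K>(2) by measurable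
  qed
  show thesis
  proof (rule that[of "from_nat_into \<A>"])
    show "from_nat_into \<A> k \<in> sets M" for k using sets from_nat_into[OF ne] by blast
    fix E and \<eta> :: real assume E: "E \<in> sets M" and \<eta>: "\<eta> > 0"
    obtain F where F: "F \<in> sets borel" and ae: "AE x in M. x \<in> E \<longleftrightarrow> \<phi> x \<in> F"
      using generated[OF E] by blast
    obtain \<K> where \<K>: "finite \<K>" "\<K> \<subseteq> \<B>"
      and m: "measure M (sym_diff {x \<in> space M. \<phi> x \<in> F} {x \<in> space M. \<phi> x \<in> \<Union>\<K>}) < \<eta>"
      using borel_approximation[OF \<B>(2,1) F \<eta>] .
    have \<K>A: "{x \<in> space M. \<phi> x \<in> \<Union>\<K>} \<in> \<A>" using \<K> by (auto simp: \<A>_def)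
    then obtain k where k: "from_nat_into \<A> k = {x \<in> space M. \<phi> x \<in> \<Union>\<K>}"
      using from_nat_into_surj[OF c] by blast
    note [measurable] = sets[OF \<K>A] E F
    have "measure M (sym_diff E {x \<in> space M. \<phi> x \<in> \<Union>\<K>}) =
        measure M (sym_diff {x \<in> space M. \<phi> x \<in> F} {x \<in> space M. \<phi> x \<in> \<Union>\<K>})"
    proof (rule measure_eq_AE)
      show "AE x in M. x \<in> sym_diff E {x \<in> space M. \<phi> x \<in> \<Union>\<K>} \<longleftrightarrow>
          x \<in> sym_diff {x \<in> space M. \<phi> x \<in> F} {x \<in> space M. \<phi> x \<in> \<Union>\<K>}"
        using ae AE_space by eventually_elim auto
    qed (use sets[OF \<K>A] E in \<open>auto intro!: sets.Un sets.Diff\<close>)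
    with m k show "\<exists>k. measure M (sym_diff E (from_nat_into \<A> k)) < \<eta>" by metis
  qed
qed

end

section \<open>Following a periodic map for a long time\<close>

lemma (in prob_space) sym_diff_triangle:
  assumes "A \<in> sets M" "B \<in> sets M" "C \<in> sets M"
  shows "measure M (sym_diff A C) \<le> measure M (sym_diff A B) + measure M (sym_diff B C)"
proof -
  have "measure M (sym_diff A C) \<le> measure M (sym_diff A B \<union> sym_diff B C)"
    using assms by (intro finite_measure_mono) auto
  also have "\<dots> \<le> measure M (sym_diff A B) + measure M (sym_diff B C)"
    using assms by (intro measure_Un_le) auto
  finally show ?thesis .
qed

text \<open>Telescoping: going from \<open>T ^^ Suc i\<close> to \<open>R ^^ Suc i\<close> one first replaces \<open>T ^^ i\<close> by \<open>R ^^ i\<close> after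
  a step of \<open>T\<close>, which costs nothing new since \<open>T\<close> preserves the measure, and then replaces that
  step, which costs \<open>d\<close>. So control of a single step of \<open>T\<close>, tested on the preimages of \<open>A\<close> under
  iterates of \<open>R\<close>, controls its iterates; this is how a weak neighbourhood reaches times up to \<open>n\<close>.\<close>
lemma (in prob_space) iterates_stay_close:
  assumes T: "T \<in> automorphisms M" and R: "R \<in> automorphisms M" and A[measurable]: "A \<in> sets M"
    and d: "\<And>j. j < n \<Longrightarrow> measure M (sym_diff {x \<in> space M. (R ^^ j) (T x) \<in> A} {x \<in> space M. (R ^^ j) (R x) \<in> A}) \<le> d"
    and "i \<le> n"
  shows "measure M (sym_diff {x \<in> space M. (T ^^ i) x \<in> A} {x \<in> space M. (R ^^ i) x \<in> A}) \<le> real i * d"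
  using \<open>i \<le> n\<close>
proof (induction i)
  case (Suc i)
  note Tm[measurable] = automorphism_measurable[OF T] and Rm[measurable] = automorphism_measurable[OF R]
  note [measurable] = measurable_funpow[OF Tm] measurable_funpow[OF Rm]
  define E where "E = sym_diff {x \<in> space M. (T ^^ i) x \<in> A} {x \<in> space M. (R ^^ i) x \<in> A}"
  have E: "E \<in> sets M" unfolding E_def by measurable
  define B C D where "B = {x \<in> space M. (T ^^ i) (T x) \<in> A}"
    and "C = {x \<in> space M. (R ^^ i) (T x) \<in> A}" and "D = {x \<in> space M. (R ^^ i) (R x) \<in> A}"
  have BCD: "B \<in> sets M" "C \<in> sets M" "D \<in> sets M" unfolding B_def C_def D_def by measurable
  have "sym_diff B C = {x \<in> space M. T x \<in> E}"
    using automorphism_in_space[OF T] by (auto simp: B_def C_def E_def)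
  then have "measure M (sym_diff B C) = measure M E"
    using distr_preserves_measure[OF Tm automorphism_distr[OF T] E] by simp
  also have "\<dots> \<le> real i * d" unfolding E_def using Suc by simp
  finally have "measure M (sym_diff B D) \<le> real i * d + d"
    using sym_diff_triangle[OF BCD] d[of i] Suc.prems by (simp add: C_def D_def)
  then show ?case by (simp add: B_def D_def funpow_swap1 algebra_simps)
qed simp

lemma (in prob_space) l2_norm_indicator_diff:
  assumes [measurable]: "S \<in> M \<rightarrow>\<^sub>M M" "R \<in> M \<rightarrow>\<^sub>M M" "B \<in> sets M"
  shows "(l2_norm M (\<lambda>x. koopman S (indicator B) x - koopman R (indicator B) x))\<^sup>2 =
    measure M (sym_diff {x \<in> space M. S x \<in> B} {x \<in> space M. R x \<in> B})"
proof -
  have "(\<integral>x. (cmod (indicator B (S x) - indicator B (R x)))\<^sup>2 \<partial>M) =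
      (\<integral>x. indicat_real (sym_diff {x \<in> space M. S x \<in> B} {x \<in> space M. R x \<in> B}) x \<partial>M)"
    by (rule Bochner_Integration.integral_cong) (auto simp: indicator_def)
  also have "\<dots> = measure M (sym_diff {x \<in> space M. S x \<in> B} {x \<in> space M. R x \<in> B})"
    by simp
  finally show ?thesis by (simp add: l2_norm_def koopman_def)
qed

text \<open>The map \<open>T\<close> follows a periodic map \<open>R\<close> up to a time \<open>n\<close> beyond \<open>m\<close>, on the first \<open>m\<close> test sets.
  The one parameter \<open>m\<close> bounds everything: the size of partitions that can be treated, hence
  \<open>(m + 1) ^ q\<close> bounds the number of names of \<open>R\<close>; the accuracy and the argument \<open>t\<close> of the rate are
  \<open>1 / (m + 1)\<close>; and the additional factor \<open>m + 1\<close> makes the number of names small relative to the rate.\<close>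
definition periodic_at_scale ::
    "'a measure \<Rightarrow> (nat \<Rightarrow> 'a set) \<Rightarrow> (nat \<Rightarrow> real \<Rightarrow> real) \<Rightarrow> nat \<Rightarrow> ('a \<Rightarrow> 'a) \<Rightarrow> bool" where
  "periodic_at_scale M A a m T \<longleftrightarrow> (\<exists>R\<in>automorphisms M. \<exists>q>0. \<exists>n>m.
     (\<forall>x\<in>space M. (R ^^ q) x = x) \<and>
     real (Suc m) * real (Suc m) ^ q \<le> a n (inverse (real (Suc m))) \<and>
     (\<forall>i<n. \<forall>k<m. measure M (sym_diff {x \<in> space M. (T ^^ i) x \<in> A k} {x \<in> space M. (R ^^ i) x \<in> A k})
        \<le> inverse (real (Suc m))))"

text \<open>The neighbourhood is given by the indicators of the preimages of the test sets under \<open>R ^^ j\<close>,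
  \<open>j < n\<close>. The period is known before \<open>n\<close> is chosen, so the growth condition can be met.\<close>
lemma (in prob_space) periodic_has_weak_neighbourhood:
  assumes R: "R \<in> automorphisms M" and q: "q > 0" and per: "\<And>x. x \<in> space M \<Longrightarrow> (R ^^ q) x = x"
    and A: "\<And>k. A k \<in> sets M"
    and a: "\<And>t. t > 0 \<Longrightarrow> filterlim (\<lambda>n. a n t) at_top sequentially"
  obtains W where "openin (weak_topology M) W" "class_of M R \<in> W"
    "\<And>c T. c \<in> W \<Longrightarrow> T \<in> c \<Longrightarrow> periodic_at_scale M A a m T"
proof -
  note Rm[measurable] = automorphism_measurable[OF R]
  note [measurable] = measurable_funpow[OF Rm] A
  define s where "s = inverse (real (Suc m))"
  have s: "s > 0" by (simp add: s_def)
  have "\<forall>\<^sub>F n in sequentially. real (Suc m) * real (Suc m) ^ q \<le> a n s"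
    using a[OF s] unfolding filterlim_at_top by blast
  then obtain n0 where n0: "\<And>n. n \<ge> n0 \<Longrightarrow> real (Suc m) * real (Suc m) ^ q \<le> a n s"
    by (auto simp: eventually_sequentially)
  define n where "n = max n0 (Suc m)"
  have n: "n > m" "n > 0" and an: "real (Suc m) * real (Suc m) ^ q \<le> a n s"
    using n0 by (auto simp: n_def)
  \<comment> \<open>each of up to \<open>n\<close> telescoping steps may cost \<open>s / n\<close>\<close>
  define e where "e = sqrt (s / real n)"
  have e: "e > 0" and e2: "e\<^sup>2 = s / real n" using s n by (auto simp: e_def)
  define B where "B kj = {x \<in> space M. (R ^^ snd kj) x \<in> A (fst kj)}" for kj
  have B[measurable]: "B kj \<in> sets M" for kj unfolding B_def by measurable
  have L2: "indicator (B kj) \<in> square_integrable M" for kj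
  proof -
    have "integrable M (\<lambda>x. (cmod (indicator (B kj) x :: complex))\<^sup>2)"
      by (rule integrable_const_bound[where B = 1]) (auto simp: indicator_def)
    then show ?thesis by (simp add: square_integrable_def)
  qed
  define W where "W = (\<Inter>kj\<in>{..<m} \<times> {..<n}. weak_subbasic M R (indicator (B kj)) e) \<inter> automorphism_classes M"
  show thesis
  proof (rule that[of W])
    show "openin (weak_topology M) W"
      unfolding W_def topspace_weak_topology[symmetric]
      by (rule openin_INT) (auto intro!: openin_weak_subbasic R L2 e)
    have "l2_norm M (\<lambda>x. koopman S (indicator (B kj)) x - koopman R (indicator (B kj)) x) < e"
      if S: "S \<in> class_of M R" for S kj
    proof -
      have "AE x in M. S x = R x"
        using class_AE_eq[OF class_of_in_classes[OF R] S in_class_of[OF R]] .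
      then have "(\<integral>x. (cmod (indicator (B kj) (S x) - indicator (B kj) (R x)))\<^sup>2 \<partial>M) = 0"
        by (intro integral_eq_zero_AE) (auto elim!: eventually_mono)
      then show ?thesis using e by (simp add: l2_norm_def koopman_def)
    qed
    then show "class_of M R \<in> W"
      using class_of_in_classes[OF R] by (auto simp: W_def weak_subbasic_def)
    fix c T assume c: "c \<in> W" and Tc: "T \<in> c"
    have cc: "c \<in> automorphism_classes M" using c by (simp add: W_def)
    have T: "T \<in> automorphisms M" using class_subset[OF cc Tc] .
    note [measurable] = automorphism_measurable[OF T]
    have "measure M (sym_diff {x \<in> space M. (T ^^ i) x \<in> A k} {x \<in> space M. (R ^^ i) x \<in> A k}) \<le> s"
      if "i < n" "k < m" for i k
    proof -
      have "measure M (sym_diff {x \<in> space M. (R ^^ j) (T x) \<in> A k} {x \<in> space M. (R ^^ j) (R x) \<in> A k}) \<le> s / real n"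
        if j: "j < n" for j
      proof -
        define f where "f = l2_norm M (\<lambda>x. koopman T (indicator (B (k, j))) x - koopman R (indicator (B (k, j))) x)"
        have "c \<in> weak_subbasic M R (indicator (B (k, j))) e" using c \<open>k < m\<close> j by (auto simp: W_def)
        then have "f < e" using Tc by (simp add: weak_subbasic_def f_def)
        moreover have "f \<ge> 0" by (simp add: f_def l2_norm_def)
        ultimately have "f\<^sup>2 \<le> e\<^sup>2" by (intro power_mono) auto
        moreover have "{x \<in> space M. (R ^^ j) (T x) \<in> A k} = {x \<in> space M. T x \<in> B (k, j)}"
          "{x \<in> space M. (R ^^ j) (R x) \<in> A k} = {x \<in> space M. R x \<in> B (k, j)}"
          using automorphism_in_space[OF T] automorphism_in_space[OF R] by (auto simp: B_def)
        ultimately show ?thesis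
          using l2_norm_indicator_diff[of T R "B (k, j)"] e2
          by (simp add: f_def automorphism_measurable T R B)
      qed
      from iterates_stay_close[OF T R A this, of n i] \<open>i < n\<close>
      have "measure M (sym_diff {x \<in> space M. (T ^^ i) x \<in> A k} {x \<in> space M. (R ^^ i) x \<in> A k}) \<le> real i * (s / real n)"
        by simp
      also have "\<dots> \<le> real n * (s / real n)" using that s by (intro mult_right_mono) auto
      finally show ?thesis using n by simp
    qed
    then show "periodic_at_scale M A a m T"
      unfolding periodic_at_scale_def s_def[symmetric] using R q n an per by blast
  qed
qed

section \<open>Covering numbers along a periodic map\<close>

lemma finite_words: "finite (words r n)" and card_words: "card (words r n) = r ^ n"
  using finite_lists_length_eq[of "{1..r}" n] card_lists_length_eq[of "{1..r}" n]
  by (simp_all add: words_def conj_commute)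

lemma finite_partition_label:
  assumes P: "finite_partition M r p" and x: "x \<in> space M"
  shows "(THE j. j \<in> {1..r} \<and> x \<in> p j) \<in> {1..r}"
    and "j \<in> {1..r} \<Longrightarrow> (THE j. j \<in> {1..r} \<and> x \<in> p j) = j \<longleftrightarrow> x \<in> p j"
proof -
  have "\<exists>!j. j \<in> {1..r} \<and> x \<in> p j"
  proof -
    obtain j where "j \<in> {1..r}" "x \<in> p j" using P x unfolding finite_partition_def by blast
    moreover have "i = j" if "i \<in> {1..r}" "x \<in> p i" "j \<in> {1..r}" "x \<in> p j" for i j
      using P that unfolding finite_partition_def disjoint_family_on_def by blast
    ultimately show ?thesis by blast
  qed
  note * = this theI'[OF this]
  show "(THE j. j \<in> {1..r} \<and> x \<in> p j) \<in> {1..r}" using *(2) by blast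
  show "(THE j. j \<in> {1..r} \<and> x \<in> p j) = j \<longleftrightarrow> x \<in> p j" if "j \<in> {1..r}"
    using * that by metis
qed

text \<open>The names of \<open>R\<close> are the centres. A name of \<open>R\<close> is determined by its first \<open>q\<close> letters, which
  gives the bound \<open>r ^ q\<close>; and the expected number of positions where the names of \<open>T\<close> and \<open>R\<close> differ
  is at most \<open>n * (r * d)\<close>, so that by Markov's inequality it exceeds \<open>\<epsilon> * n\<close> on a set of measure at most \<open>\<delta>\<close>
  only.\<close>
lemma covering_number_near_periodic:
  assumes "prob_space M" and P: "finite_partition M r p"
    and T[measurable]: "T \<in> M \<rightarrow>\<^sub>M M" and R[measurable]: "R \<in> M \<rightarrow>\<^sub>M M"
    and q: "q > 0" and per: "\<And>x. x \<in> space M \<Longrightarrow> (R ^^ q) x = x"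
    and d: "\<And>i j. i < n \<Longrightarrow> j \<in> {1..r} \<Longrightarrow>
      measure M (sym_diff {x \<in> space M. (T ^^ i) x \<in> p j} {x \<in> space M. (R ^^ i) x \<in> p j}) \<le> d"
    and \<epsilon>: "\<epsilon> > 0" and n: "n > 0" and small: "real r * d \<le> \<epsilon> * \<delta>"
  shows "covering_number M r p T n \<epsilon> \<delta> \<le> r ^ q"
proof -
  interpret prob_space M by fact
  note Tn[measurable] = measurable_funpow[OF T] and Rn[measurable] = measurable_funpow[OF R]
  define label where "label x = (THE j. j \<in> {1..r} \<and> x \<in> p j)" for x
  have lab: "label x \<in> {1..r}" "j \<in> {1..r} \<Longrightarrow> label x = j \<longleftrightarrow> x \<in> p j" if "x \<in> space M" for x j
    using finite_partition_label[OF P that] by (auto simp: label_def)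
  have p[measurable]: "p j \<in> sets M" if "j \<in> {1..r}" for j
    using P that by (auto simp: finite_partition_def)
  have lab_meas[measurable]: "label \<in> M \<rightarrow>\<^sub>M count_space UNIV"
  proof (subst measurable_count_space_eq2_countable, intro conjI ballI)
    fix j :: nat
    have "label -` {j} \<inter> space M = (if j \<in> {1..r} then p j else {})"
    proof (cases "j \<in> {1..r}")
      case True
      then show ?thesis using lab(2)[OF _ True] sets.sets_into_space[OF p[OF True]] by auto
    next
      case False
      then show ?thesis using lab(1) by auto
    qed
    then show "label -` {j} \<inter> space M \<in> sets M" using p by auto
  qed auto
  note [measurable] = measurable_compose[OF Tn lab_meas] measurable_compose[OF Rn lab_meas]
  have spT: "(T ^^ i) x \<in> space M" and spR: "(R ^^ i) x \<in> space M" if "x \<in> space M" for i x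
    using measurable_space[OF Tn that] measurable_space[OF Rn that] by auto
  have ow: "orbit_word r p Q n x = map (\<lambda>i. label ((Q ^^ i) x)) [0..<n]" for Q n x
    by (simp add: orbit_word_def label_def)
  have dist: "hamming_dist (orbit_word r p Q n x) w =
      (\<Sum>i<n. if label ((Q ^^ i) x) \<noteq> w ! i then 1 else 0) / real n" for Q x w n
  proof -
    have "{i. i < length (orbit_word r p Q n x) \<and> orbit_word r p Q n x ! i \<noteq> w ! i}
        = {i\<in>{..<n}. label ((Q ^^ i) x) \<noteq> w ! i}" by (auto simp: ow)
    then show ?thesis by (simp add: hamming_dist_def ow sum.If_cases Int_def)
  qed
  have ball: "hamming_ball M r p T \<epsilon> v \<in> sets M" for v
    unfolding hamming_ball_def dist by measurable
  define E where "E i = {x \<in> space M. label ((T ^^ i) x) \<noteq> label ((R ^^ i) x)}" for i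
  have E[measurable]: "E i \<in> sets M" for i
  proof -
    have "E i = {x \<in> space M. \<exists>j. label ((T ^^ i) x) = j \<and> label ((R ^^ i) x) \<noteq> j}"
      by (auto simp: E_def)
    also have "\<dots> \<in> sets M" by measurable
    finally show ?thesis .
  qed
  have mE: "measure M (E i) \<le> real r * d" if i: "i < n" for i
  proof -
    define F where "F j = sym_diff {x \<in> space M. (T ^^ i) x \<in> p j} {x \<in> space M. (R ^^ i) x \<in> p j}" for j
    have F: "F j \<in> sets M" if "j \<in> {1..r}" for j
    proof -
      note [measurable] = p[OF that]
      show ?thesis unfolding F_def by measurable
    qed
    have "E i \<subseteq> (\<Union>j\<in>{1..r}. F j)"
    proof
      fix x assume "x \<in> E i"
      then have x: "x \<in> space M" "label ((T ^^ i) x) \<noteq> label ((R ^^ i) x)" by (auto simp: E_def)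
      define j where "j = label ((T ^^ i) x)"
      have j: "j \<in> {1..r}" using lab(1)[OF spT[OF x(1)]] by (simp add: j_def)
      have "(T ^^ i) x \<in> p j" "(R ^^ i) x \<notin> p j"
        using lab(2)[OF spT[OF x(1)] j, of i] lab(2)[OF spR[OF x(1)] j, of i] x(2) by (auto simp: j_def)
      then show "x \<in> (\<Union>j\<in>{1..r}. F j)" using x(1) j by (auto simp: F_def)
    qed
    then have "measure M (E i) \<le> measure M (\<Union>j\<in>{1..r}. F j)"
      using F by (intro finite_measure_mono sets.finite_UN) auto
    also have "\<dots> \<le> (\<Sum>j\<in>{1..r}. measure M (F j))"
      by (rule measure_UNION_le) (use F in auto)
    also have "\<dots> \<le> (\<Sum>j\<in>{1..r}. d)"
      unfolding F_def by (rule sum_mono) (use d i in auto)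
    finally show ?thesis by simp
  qed
  define D where "D x = (\<Sum>i<n. indicat_real (E i) x)" for x
  have Di: "integrable M D"
    unfolding D_def by (intro Bochner_Integration.integrable_sum integrable_real_indicator)
      (auto simp: emeasure_eq_measure)
  have [measurable]: "D \<in> borel_measurable M" using Di by auto
  have "(\<integral>x. D x \<partial>M) = (\<Sum>i<n. measure M (E i))"
    unfolding D_def by (subst Bochner_Integration.integral_sum)
      (auto intro!: integrable_real_indicator simp: emeasure_eq_measure)
  also have "\<dots> \<le> (\<Sum>i<n. real r * d)" by (rule sum_mono) (use mE in auto)
  also have "\<dots> = real n * (real r * d)" by simp
  also have "\<dots> \<le> real n * (\<epsilon> * \<delta>)" using small by (intro mult_left_mono) auto
  finally have Dle: "(\<integral>x. D x \<partial>M) \<le> real n * (\<epsilon> * \<delta>)" .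
  have pos: "\<epsilon> * real n > 0" using \<epsilon> n by simp
  define bad where "bad = {x \<in> space M. D x \<ge> \<epsilon> * real n}"
  have [measurable]: "bad \<in> sets M" unfolding bad_def by measurable
  have "measure M bad \<le> (\<integral>x. D x \<partial>M) / (\<epsilon> * real n)"
    unfolding bad_def
    by (rule integral_Markov_inequality_measure[OF Di sets.empty_sets])
       (use pos in \<open>auto simp: D_def intro!: sum_nonneg\<close>)
  also have "\<dots> \<le> \<delta>" using Dle pos by (simp add: divide_le_eq mult_ac)
  finally have bad: "measure M bad \<le> \<delta>" .
  define C where "C = orbit_word r p R n ` space M"
  have Cw: "C \<subseteq> words r n"
    using lab(1)[OF spR] by (auto simp: C_def words_def ow)
  have "C \<subseteq> (\<lambda>w. map (\<lambda>i. w ! (i mod q)) [0..<n]) ` words r q"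
  proof
    fix w assume "w \<in> C"
    then obtain x where x: "x \<in> space M" "w = orbit_word r p R n x" by (auto simp: C_def)
    have "w = map (\<lambda>i. orbit_word r p R q x ! (i mod q)) [0..<n]"
      using q by (simp add: x(2) ow funpow_mod_eq[OF per[OF x(1)]])
    moreover have "orbit_word r p R q x \<in> words r q"
      using lab(1)[OF spR[OF x(1)]] by (auto simp: words_def ow)
    ultimately show "w \<in> (\<lambda>w. map (\<lambda>i. w ! (i mod q)) [0..<n]) ` words r q" by blast
  qed
  then have "card C \<le> card (words r q)" using surj_card_le finite_words by blast
  then have cC: "card C \<le> r ^ q" by (simp add: card_words)
  have "finite C" using Cw finite_words finite_subset by blast
  then obtain vs where vs: "set vs = C" "length vs = card C"
    using finite_distinct_list distinct_card by metis
  have "1 - \<delta> \<le> measure M (space M - bad)" using bad by (simp add: prob_compl)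
  also have "\<dots> \<le> measure M (\<Union>v\<in>set vs. hamming_ball M r p T \<epsilon> v)"
  proof (rule finite_measure_mono)
    show "(\<Union>v\<in>set vs. hamming_ball M r p T \<epsilon> v) \<in> sets M" using ball by auto
    show "space M - bad \<subseteq> (\<Union>v\<in>set vs. hamming_ball M r p T \<epsilon> v)"
    proof
      fix x assume x: "x \<in> space M - bad"
      define v where "v = orbit_word r p R n x"
      have lv: "length v = n" by (simp add: v_def ow)
      have "(\<Sum>i<n. if label ((T ^^ i) x) \<noteq> v ! i then 1 else 0) = D x"
        unfolding D_def by (rule sum.cong) (use x in \<open>auto simp: v_def ow E_def\<close>)
      then have "hamming_dist (orbit_word r p T n x) v < \<epsilon>"
        using x n unfolding dist by (auto simp: bad_def divide_less_eq)
      then have "x \<in> hamming_ball M r p T \<epsilon> v" using x by (simp add: hamming_ball_def lv)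
      moreover have "v \<in> set vs" using x by (simp add: vs C_def v_def)
      ultimately show "x \<in> (\<Union>v\<in>set vs. hamming_ball M r p T \<epsilon> v)" by blast
    qed
  qed
  finally have "covering_number M r p T n \<epsilon> \<delta> \<le> length vs"
    unfolding covering_number_def using Cw vs(1) by (intro Least_le) blast
  then show ?thesis using cC vs by simp
qed

text \<open>A positive lower limit would bound the ratio of covering number and rate below by some \<open>c > 0\<close> at
  all large times. For \<open>m\<close> large enough the test sets approximate the atoms of the given partition, and
  the time \<open>n > m\<close> provided by scale \<open>m\<close> has ratio at most \<open>1 / (m + 1) < c\<close>. Monotonicity of the rate
  allows for the argument \<open>1 / (m + 1)\<close> in place of \<open>t\<close>.\<close>
lemma lower_growth_params_empty:
  assumes M: "prob_space M" and T: "T \<in> automorphisms M"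
    and A: "\<And>k. A k \<in> sets M"
    and dense: "\<And>E \<eta>. E \<in> sets M \<Longrightarrow> \<eta> > 0 \<Longrightarrow> \<exists>k. measure M (sym_diff E (A k)) < \<eta>"
    and per: "\<And>m. periodic_at_scale M A a m T"
    and a_pos: "\<And>n t. t > 0 \<Longrightarrow> a n t > 0"
    and a_mono: "\<And>n s t. 0 < s \<Longrightarrow> s < t \<Longrightarrow> a n s \<le> a n t"
    and P: "finite_partition M r p" and \<epsilon>: "\<epsilon> > 0" and \<delta>: "\<delta> > 0"
  shows "lower_growth_params M a T r p \<epsilon> \<delta> = {}"
proof (rule ccontr)
  interpret prob_space M by fact
  assume "lower_growth_params M a T r p \<epsilon> \<delta> \<noteq> {}"
  then obtain t where t: "t > 0"
    and lim: "0 < liminf (\<lambda>n. ereal (real (covering_number M r p T n \<epsilon> \<delta>) / a n t))"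
    by (auto simp: lower_growth_params_def)
  obtain c where c0: "0 < ereal c"
    and c: "ereal c < liminf (\<lambda>n. ereal (real (covering_number M r p T n \<epsilon> \<delta>) / a n t))"
    using ereal_dense2[OF lim] by blast
  obtain n0 where n0: "\<And>n. n \<ge> n0 \<Longrightarrow> c < real (covering_number M r p T n \<epsilon> \<delta>) / a n t"
    using less_LiminfD[OF c] by (auto simp: eventually_sequentially)
  \<comment> \<open>an atom costs \<open>\<eta>\<close> three times: twice for its test set, once for passing from \<open>T\<close> to \<open>R\<close>\<close>
  define \<eta> where "\<eta> = \<epsilon> * \<delta> / (3 * real (Suc r))"
  have \<eta>: "\<eta> > 0" using \<epsilon> \<delta> by (simp add: \<eta>_def)
  have p: "p j \<in> sets M" if "j \<in> {1..r}" for j using P that by (auto simp: finite_partition_def)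
  have "\<forall>j\<in>{1..r}. \<exists>k. measure M (sym_diff (p j) (A k)) < \<eta>" using dense[OF p \<eta>] by blast
  then obtain \<kappa> where \<kappa>: "\<And>j. j \<in> {1..r} \<Longrightarrow> measure M (sym_diff (p j) (A (\<kappa> j))) < \<eta>" by metis
  obtain m0 where m0: "inverse (real (Suc m0)) < min \<eta> (min c t)"
    using reals_Archimedean[of "min \<eta> (min c t)"] \<eta> c0 t by auto
  define ms where "ms = {m0, n0, r} \<union> (\<lambda>j. Suc (\<kappa> j)) ` {1..r}"
  define m where "m = Max ms"
  have ms: "k \<le> m" if "k \<in> ms" for k
    unfolding m_def by (rule Max_ge[OF _ that]) (simp add: ms_def)
  have m: "m0 \<le> m" "n0 \<le> m" "r \<le> m" using ms by (simp_all add: ms_def)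
  have m\<kappa>: "\<kappa> j < m" if "j \<in> {1..r}" for j
    using ms[of "Suc (\<kappa> j)"] that by (simp add: ms_def)
  define s where "s = inverse (real (Suc m))"
  have "s \<le> inverse (real (Suc m0))" using m(1) by (simp add: s_def)
  then have "s < min \<eta> (min c t)" using m0 by (rule le_less_trans)
  then have s: "s > 0" "s < \<eta>" "s < c" "s < t" by (simp_all add: s_def)
  obtain R q n where R: "R \<in> automorphisms M" and q: "q > 0" and n: "n > m"
    and Rq: "\<And>x. x \<in> space M \<Longrightarrow> (R ^^ q) x = x"
    and an: "real (Suc m) * real (Suc m) ^ q \<le> a n s"
    and close: "\<And>i k. i < n \<Longrightarrow> k < m \<Longrightarrow>
      measure M (sym_diff {x \<in> space M. (T ^^ i) x \<in> A k} {x \<in> space M. (R ^^ i) x \<in> A k}) \<le> s"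
    using per[of m] unfolding periodic_at_scale_def s_def[symmetric] by blast
  note Tm = automorphism_measurable[OF T] and Rm = automorphism_measurable[OF R]
  note Tn[measurable] = measurable_funpow[OF Tm] and Rn[measurable] = measurable_funpow[OF Rm]
  have Td: "distr M M (T ^^ i) = M" and Rd: "distr M M (R ^^ i) = M" for i
    using distr_funpow Tm Rm automorphism_distr T R by metis+
  have names_close: "measure M (sym_diff {x \<in> space M. (T ^^ i) x \<in> p j} {x \<in> space M. (R ^^ i) x \<in> p j}) \<le> 3 * \<eta>"
    if i: "i < n" and j: "j \<in> {1..r}" for i j
  proof -
    note [measurable] = p[OF j] A
    define E where "E = sym_diff (p j) (A (\<kappa> j))"
    have E: "E \<in> sets M" unfolding E_def by measurable
    define F where "F Q S = {x \<in> space M. (Q ^^ i) x \<in> S}" for Q and S :: "'a set"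
    have [measurable]: "F T (p j) \<in> sets M" "F T (A (\<kappa> j)) \<in> sets M"
      "F R (p j) \<in> sets M" "F R (A (\<kappa> j)) \<in> sets M"
      unfolding F_def by measurable
    have "sym_diff (F T (p j)) (F T (A (\<kappa> j))) = {x \<in> space M. (T ^^ i) x \<in> E}"
      "sym_diff (F R (A (\<kappa> j))) (F R (p j)) = {x \<in> space M. (R ^^ i) x \<in> E}"
      by (auto simp: F_def E_def)
    then have 1: "measure M (sym_diff (F T (p j)) (F T (A (\<kappa> j)))) \<le> \<eta>"
      "measure M (sym_diff (F R (A (\<kappa> j))) (F R (p j))) \<le> \<eta>"
      using distr_preserves_measure[OF Tn Td E] distr_preserves_measure[OF Rn Rd E] \<kappa>[OF j]
      by (simp_all add: E_def)
    have 2: "measure M (sym_diff (F T (A (\<kappa> j))) (F R (A (\<kappa> j)))) \<le> \<eta>"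
      using close[OF i m\<kappa>[OF j]] s(2) by (simp add: F_def)
    have "measure M (sym_diff (F T (p j)) (F R (p j))) \<le> measure M (sym_diff (F T (p j)) (F T (A (\<kappa> j))))
        + (measure M (sym_diff (F T (A (\<kappa> j))) (F R (A (\<kappa> j)))) + measure M (sym_diff (F R (A (\<kappa> j))) (F R (p j))))"
      by (rule order_trans[OF sym_diff_triangle add_left_mono[OF sym_diff_triangle]]) measurable
    then show ?thesis using 1 2 by (simp add: F_def)
  qed
  have "real r * (3 * \<eta>) = \<epsilon> * \<delta> * (real r / real (Suc r))"
    unfolding \<eta>_def by (simp add: field_simps del: of_nat_Suc)
  also have "\<dots> \<le> \<epsilon> * \<delta> * 1" using \<epsilon> \<delta> by (intro mult_left_mono) (auto simp: divide_le_eq)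
  finally have small: "real r * (3 * \<eta>) \<le> \<epsilon> * \<delta>" by simp
  have "covering_number M r p T n \<epsilon> \<delta> \<le> r ^ q"
    using covering_number_near_periodic[OF M P Tm Rm q Rq names_close \<epsilon> _ small] n by simp
  then have "real (covering_number M r p T n \<epsilon> \<delta>) \<le> real r ^ q"
    by (metis of_nat_le_iff of_nat_power)
  also have "\<dots> \<le> real (Suc m) ^ q" using m(3) by (intro power_mono) auto
  also have "\<dots> = s * (real (Suc m) * real (Suc m) ^ q)" by (simp add: s_def)
  also have "\<dots> \<le> s * a n s" using an s(1) by (intro mult_left_mono) auto
  also have "\<dots> \<le> s * a n t" using a_mono[OF s(1) s(4), of n] s(1) by (intro mult_left_mono) auto
  finally have "real (covering_number M r p T n \<epsilon> \<delta>) / a n t \<le> s"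
    using a_pos[OF t, of n] by (simp add: divide_le_eq)
  then show False using n0[of n] n m(2) s(3) by simp
qed

lemma lower_slow_entropy_eq_0:
  assumes M: "space M \<noteq> {}"
    and empty: "\<And>r p \<epsilon> \<delta>. finite_partition M r p \<Longrightarrow> \<epsilon> > 0 \<Longrightarrow> \<delta> > 0 \<Longrightarrow>
      lower_growth_params M a T r p \<epsilon> \<delta> = {}"
  shows "lower_slow_entropy M a T = 0"
proof -
  have z: "lower_slow_entropy_partition M a T r p = 0" if P: "finite_partition M r p" for r p
  proof -
    have pos: "\<forall>\<^sub>F x in at_right 0. (x::real) > 0" by (simp add: eventually_at_right_less)
    have inner: "Lim (at_right 0) (\<lambda>\<epsilon>. lower_slow_entropy_at M a T r p \<epsilon> \<delta>) = 0" if "\<delta> > 0" for \<delta>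
    proof (rule tendsto_Lim)
      show "((\<lambda>\<epsilon>. lower_slow_entropy_at M a T r p \<epsilon> \<delta>) \<longlongrightarrow> 0) (at_right 0)"
        by (rule tendsto_eventually, rule eventually_mono[OF pos])
           (use empty[OF P _ that] in \<open>simp add: lower_slow_entropy_at_def\<close>)
    qed simp
    show ?thesis unfolding lower_slow_entropy_partition_def
    proof (rule tendsto_Lim)
      show "((\<lambda>\<delta>. Lim (at_right 0) (\<lambda>\<epsilon>. lower_slow_entropy_at M a T r p \<epsilon> \<delta>)) \<longlongrightarrow> 0) (at_right 0)"
        by (rule tendsto_eventually, rule eventually_mono[OF pos]) (use inner in simp)
    qed simp
  qed
  have "finite_partition M 1 (\<lambda>_. space M)"
    using M by (auto simp: finite_partition_def disjoint_family_on_def)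
  then have ne: "{(r, p). finite_partition M r p} \<noteq> {}" by blast
  have "lower_slow_entropy M a T = (SUP rp \<in> {(r, p). finite_partition M r p}. 0)"
    unfolding lower_slow_entropy_def by (rule SUP_cong) (auto simp: z)
  then show ?thesis using ne by simp
qed

section \<open>Standard spaces are separated\<close>

text \<open>The isomorphism itself, extended by an arbitrary constant, is the function \<open>\<phi>\<close>. The last
  hypothesis allows the \<open>\<sigma>\<close>-algebra of the model to be larger than the Borel one by null sets.\<close>
lemma separated_if_isomorphic:
  fixes L :: "real measure"
  assumes iso: "isomorphic_mod_null M L" and L: "prob_space L"
    and id: "(\<lambda>x. x) \<in> borel_measurable L"
    and borel: "\<And>E. E \<in> sets L \<Longrightarrow> \<exists>F\<in>sets borel. AE y in L. y \<in> E \<longleftrightarrow> y \<in> F"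
  obtains \<phi> N where "separated_prob_space M \<phi> N"
proof -
  interpret L: prob_space L by fact
  obtain A B f where A: "A \<in> null_sets M" and B: "B \<in> null_sets L"
    and f: "measure_isomorphism (restrict_space M (space M - A)) (restrict_space L (space L - B)) f"
    using iso unfolding isomorphic_mod_null_def by blast
  define M' L' where "M' = restrict_space M (space M - A)" and "L' = restrict_space L (space L - B)"
  have Am[measurable]: "A \<in> sets M" and Bm[measurable]: "B \<in> sets L" using A B by auto
  have M'space: "space M' = space M - A" and L'space: "space L' = space L - B"
    by (auto simp: M'_def L'_def space_restrict_space)
  have M's: "(space M - A) \<inter> space M \<in> sets M" and L's: "(space L - B) \<inter> space L \<in> sets L" by auto
  have bij: "bij_betw f (space M') (space L')" and fm: "f \<in> M' \<rightarrow>\<^sub>M L'"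
    and gm: "the_inv_into (space M') f \<in> L' \<rightarrow>\<^sub>M M'" and df: "distr M' L' f = L'"
    using f by (auto simp: measure_isomorphism_def M'_def L'_def)
  have AEM: "(AE x in M'. Q x) \<longleftrightarrow> (AE x in M. x \<in> space M - A \<longrightarrow> Q x)" for Q
    unfolding M'_def by (rule AE_restrict_space_iff[OF M's])
  have AEL: "(AE x in L'. Q x) \<longleftrightarrow> (AE x in L. x \<in> space L - B \<longrightarrow> Q x)" for Q
    unfolding L'_def by (rule AE_restrict_space_iff[OF L's])
  have prob: "prob_space M"
  proof
    have "emeasure M (space M) = emeasure M (space M - A)"
      using A by (simp add: emeasure_Diff_null_set)
    also have "\<dots> = emeasure M' (space M')"
      using M's by (simp add: M'_def space_restrict_space emeasure_restrict_space)
    also have "\<dots> = emeasure (distr M' L' f) (space L')"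
      using measurable_space[OF fm] by (subst emeasure_distr[OF fm]) (auto intro!: arg_cong[where f = "emeasure M'"])
    also have "\<dots> = emeasure L' (space L')" by (simp only: df)
    also have "\<dots> = emeasure L (space L - B)"
      using L's by (simp add: L'_def space_restrict_space emeasure_restrict_space)
    also have "\<dots> = 1" using B by (simp add: emeasure_Diff_null_set L.emeasure_space_1)
    finally show "emeasure M (space M) = 1" .
  qed
  define \<phi> where "\<phi> x = (if x \<in> space M - A then f x else 0)" for x
  have "(\<lambda>x. x) \<in> borel_measurable L'"
    unfolding L'_def by (rule measurable_restrict_space1[OF id])
  then have "f \<in> borel_measurable M'" using measurable_compose[OF fm, of "\<lambda>x. x" borel] by simp
  then have "\<phi> \<in> borel_measurable M"
    unfolding M'_def \<phi>_def[abs_def] by (subst (asm) measurable_restrict_space_iff[OF M's]) auto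
  moreover have "inj_on \<phi> (space M - A)"
    using bij unfolding M'space bij_betw_def by (auto simp: \<phi>_def inj_on_def)
  moreover have "\<exists>F\<in>sets borel. AE x in M. x \<in> E \<longleftrightarrow> \<phi> x \<in> F" if E: "E \<in> sets M" for E
  proof -
    have E': "E - A \<in> sets M'"
      using E sets.sets_into_space[OF E] by (auto simp: M'_def sets_restrict_space_iff[OF M's])
    define G where "G = the_inv_into (space M') f -` (E - A) \<inter> space L'"
    have "G \<in> sets L'" unfolding G_def using measurable_sets[OF gm E'] .
    then have "G \<in> sets L" by (simp add: L'_def sets_restrict_space_iff[OF L's])
    then obtain F where F: "F \<in> sets borel" and ae: "AE y in L. y \<in> G \<longleftrightarrow> y \<in> F" using borel by blast
    have "AE y in L'. y \<in> G \<longleftrightarrow> y \<in> F" unfolding AEL using ae by eventually_elim simp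
    then have "AE y in distr M' L' f. y \<in> G \<longleftrightarrow> y \<in> F" by (simp only: df)
    then have "AE x in M'. f x \<in> G \<longleftrightarrow> f x \<in> F" by (rule AE_distrD[OF fm])
    then have "AE x in M. x \<in> space M - A \<longrightarrow> (f x \<in> G \<longleftrightarrow> f x \<in> F)" by (simp only: AEM)
    then have "AE x in M. x \<in> E \<longleftrightarrow> \<phi> x \<in> F" using AE_not_in[OF A] AE_space
    proof eventually_elim
      case (elim x)
      then have x: "x \<in> space M'" by (simp add: M'space)
      have "f x \<in> space L'" using measurable_space[OF fm x] .
      moreover have "the_inv_into (space M') f (f x) = x"
        using the_inv_into_f_f bij x by (metis bij_betw_def)
      ultimately show ?case using elim by (simp add: G_def \<phi>_def)
    qed
    with F show ?thesis by blast
  qed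
  ultimately have "separated_prob_space M \<phi> A"
    using prob A by (simp add: separated_prob_space_def separated_prob_space_axioms_def)
  then show thesis by (rule that)
qed

lemma standard_imp_separated:
  assumes "standard_probability_space M"
  obtains \<phi> N where "separated_prob_space M \<phi> N"
proof -
  consider "isomorphic_mod_null M (restrict_space lborel {0..1::real})"
    | "isomorphic_mod_null M (lebesgue_on {0..1::real})"
    using assms by (auto simp: standard_probability_space_def)
  then show thesis
  proof cases
    case 1
    show thesis
    proof (rule separated_if_isomorphic[OF 1])
      show "prob_space (restrict_space lborel {0..1::real})"
        by (rule prob_spaceI) (simp add: emeasure_restrict_space space_restrict_space)
      show "(\<lambda>x. x) \<in> borel_measurable (restrict_space lborel {0..1::real})"
        by (rule measurable_restrict_space1) simp
      show "\<exists>F\<in>sets borel. AE y in restrict_space lborel {0..1::real}. y \<in> E \<longleftrightarrow> y \<in> F"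
        if "E \<in> sets (restrict_space lborel {0..1::real})" for E
        using that by (intro bexI[of _ E]) (auto simp: sets_restrict_space)
    qed (rule that)
  next
    case 2
    show thesis
    proof (rule separated_if_isomorphic[OF 2])
      show "prob_space (lebesgue_on {0..1::real})"
        by (rule prob_spaceI) (simp add: emeasure_restrict_space space_restrict_space)
      show "(\<lambda>x. x) \<in> borel_measurable (lebesgue_on {0..1::real})"
        by (rule measurable_restrict_space1) (simp add: measurable_completion)
      fix E assume "E \<in> sets (lebesgue_on {0..1::real})"
      then have "E \<in> sets (completion lborel)" by (auto simp: sets_restrict_space)
      then obtain S N N' where E: "E = S \<union> N" "N \<subseteq> N'" "N' \<in> null_sets lborel" "S \<in> sets lborel"
        by (rule sets_completionE)
      have "AE y in lborel. y \<in> E \<longleftrightarrow> y \<in> S"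
        using AE_not_in[OF E(3)] by eventually_elim (use E in auto)
      then have "AE y in lebesgue. y \<in> E \<longleftrightarrow> y \<in> S" by (rule AE_completion)
      then have "AE y in lebesgue_on {0..1}. y \<in> E \<longleftrightarrow> y \<in> S"
        by (subst AE_restrict_space_iff) (auto elim: eventually_mono)
      then show "\<exists>F\<in>sets borel. AE y in lebesgue_on {0..1}. y \<in> E \<longleftrightarrow> y \<in> F"
        using E(4) by auto
    qed (rule that)
  qed
qed

section \<open>The generic set\<close>

theorem theorem2:
  fixes M :: "'a measure" and a :: "nat \<Rightarrow> real \<Rightarrow> real"
  assumes "standard_probability_space M"
    and "\<And>n t. t > 0 \<Longrightarrow> a n t > 0"
    and "\<And>n s t. 0 < s \<Longrightarrow> s < t \<Longrightarrow> a n s \<le> a n t"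
    and "\<And>t. t > 0 \<Longrightarrow> filterlim (\<lambda>n. a n t) at_top sequentially"
  shows "\<exists>G. gdelta_in (weak_topology M) G \<and>
             weak_topology M closure_of G = automorphism_classes M \<and>
             (\<forall>c\<in>G. \<forall>T\<in>c. lower_slow_entropy M a T = 0)"
proof -
  obtain \<phi> N where "separated_prob_space M \<phi> N" using standard_imp_separated[OF assms(1)] .
  then interpret separated_prob_space M \<phi> N .
  obtain A :: "nat \<Rightarrow> 'a set" where A: "\<And>k. A k \<in> sets M"
    and dense: "\<And>E \<eta>. E \<in> sets M \<Longrightarrow> \<eta> > 0 \<Longrightarrow> \<exists>k. measure M (sym_diff E (A k)) < \<eta>"
    using countable_dense_sets by blast
  define U where "U m = \<Union>{W. openin (weak_topology M) W \<and>
      (\<forall>c\<in>W. \<forall>T\<in>c. periodic_at_scale M A a m T)}" for m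
  define G where "G = (\<Inter>m. U m)"
  have U_open: "openin (weak_topology M) (U m)" for m unfolding U_def by (rule openin_Union) blast
  have U_sub: "U m \<subseteq> automorphism_classes M" for m
    using openin_subset[OF U_open] by (simp add: topspace_weak_topology)
  have U_dense: "class_metric.mtopology closure_of U m = automorphism_classes M" for m
    unfolding class_metric.metric_closure_of
  proof (intro equalityI subsetI CollectI conjI allI impI)
    fix c and e :: real assume c: "c \<in> automorphism_classes M" and e: "e > 0"
    obtain T where Tc: "T \<in> c" using class_nonempty[OF c] by blast
    obtain R q where R: "R \<in> automorphisms M" and q: "q > 0"
      and per: "\<And>x. x \<in> space M \<Longrightarrow> (R ^^ q) x = x" and TR: "discrepancy T R < e"
      by (rule periodic_approximation[OF class_subset[OF c Tc] e]) (rule that)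
    obtain W where "openin (weak_topology M) W" "class_of M R \<in> W"
      "\<And>c T. c \<in> W \<Longrightarrow> T \<in> c \<Longrightarrow> periodic_at_scale M A a m T"
      by (rule periodic_has_weak_neighbourhood[OF R q per A assms(4), where m = m])
        (assumption | rule that)+
    then have "class_of M R \<in> U m" unfolding U_def by blast
    moreover have "class_of M R \<in> class_metric.mball c e"
      using TR c class_of_in_classes[OF R]
        class_dist_eq[OF c class_of_in_classes[OF R] Tc in_class_of[OF R]] by simp
    ultimately show "\<exists>y\<in>U m. y \<in> class_metric.mball c e" by blast
  qed auto
  have "class_metric.mtopology closure_of \<Inter>(range U) = automorphism_classes M"
    by (rule class_metric.metric_Baire_category[OF mcomplete_classes])
       (use weak_open_imp_metric_open[OF U_open] U_dense in auto)
  then have metric_dense: "class_metric.mtopology closure_of G = automorphism_classes M"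
    by (simp add: G_def)
  have "gdelta_in (weak_topology M) G"
    unfolding G_def by (rule gdelta_in_Inter) (auto intro: open_imp_gdelta_in U_open)
  moreover have "weak_topology M closure_of G = automorphism_classes M"
  proof
    show "weak_topology M closure_of G \<subseteq> automorphism_classes M"
      using closure_of_subset_topspace topspace_weak_topology by metis
    show "automorphism_classes M \<subseteq> weak_topology M closure_of G"
    proof
      fix c assume c: "c \<in> automorphism_classes M"
      then have "c \<in> class_metric.mtopology closure_of G" using metric_dense by simp
      then have "\<exists>y. y \<in> G \<and> y \<in> W" if "c \<in> W" "openin (weak_topology M) W" for W
        using that(1) weak_open_imp_metric_open[OF that(2)] unfolding in_closure_of by blast
      then show "c \<in> weak_topology M closure_of G"
        using c unfolding in_closure_of topspace_weak_topology by simp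
    qed
  qed
  moreover have "lower_slow_entropy M a T = 0" if c: "c \<in> G" and T: "T \<in> c" for c T
  proof -
    have cc: "c \<in> automorphism_classes M" using c U_sub by (auto simp: G_def)
    have "periodic_at_scale M A a m T" for m
    proof -
      have "c \<in> U m" using c by (simp add: G_def)
      then show ?thesis using T unfolding U_def by blast
    qed
    from lower_growth_params_empty[OF prob_space_axioms class_subset[OF cc T] A dense this assms(2,3)]
    show ?thesis by (intro lower_slow_entropy_eq_0 not_empty)
  qed
  ultimately show ?thesis by blast
qed

end
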